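(* Let $(A,+,[-,-],(-,-,-))$ be a nonzero Akivis algebra over a field $k$ with a $k$-basis $\{e_i\mid i\in I\}$ indexed by a well-ordered set $I$. Write $[e_i,e_j]=\sum_m \alpha_{ij}^m e_m$ and $(e_i,e_j,e_l)=\sum_n \beta_{ijl}^n e_n$ with $\alpha_{ij}^m,\beta_{ijl}^n\in k$ (finite sums), and denote by $\{e_ie_j\}=\sum_m\alpha_{ij}^m e_m$ and $\{e_ie_je_l\}=\sum_n\beta_{ijl}^n e_n$ the corresponding linear elements of the free non-associative algebra $M(\{e_i\}_I)$. Let $$U(A)=M(\{e_i\}_I)/J,$$ where $J$ is the two-sided ideal generated by all elements $e_ie_j-e_je_i-\{e_ie_j\}$ $(i,j\in I)$ and $(e_ie_j)e_l-e_i(e_je_l)-\{e_ie_je_l\}$ $(i,j,l\in I)$, be the universal enveloping non-associative algebra of $A$. Let $S\subset M(\{e_i\}_I)$ be the set consisting of - $f_{ij}=e_ie_j-e_je_i-\{e_ie_j\}$ for $i>j$; - $g_{ijl}=(e_ie_j)e_l-e_i(e_je_l)-\{e_ie_je_l\}$ for $i,j,l\in I$; - $h_{ijl}=e_i(e_je_l)-e_j(e_ie_l)-\{e_ie_j\}e_l-\{e_je_ie_l\}+\{e_ie_je_l\}$ for $i>j$, $l\ge j$. Then: (i) $S$ is a Gröbner-Shirshov basis in $M(\{e_i\}_I)$ (with respect to the deg-lex ordering). (ii) The set $Irr(S)$ of all non-associative words $u\in\{e_i\mid i\in I\}^{**}$ that contain none of the words $e_ie_j$ $(i>j)$, $(e_ie_j)e_l$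 $(i,j,l\in I)$, $e_i(e_je_l)$ $(i>j,\ l\ge j)$ as a subword is a linear basis of $U(A)$. (iii) $A$ can be embedded into its universal enveloping non-associative algebra $U(A)$, i.e. the linear map $A\to U(A)$ sending each $e_i$ to the class of $e_i$ is injective.
   Context: An Akivis algebra over a field $k$ is a $k$-vector space $V$ with a skew-symmetric bilinear product $[x,y]$ (meaning $[x,x]=0$ for all $x$, hence $[x,y]=-[y,x]$) and a trilinear product $(x,y,z)$ satisfying $$[[x,y],z]+[[y,z],x]+[[z,x],y]=(x,y,z)+(z,x,y)+(y,z,x)-(x,z,y)-(y,x,z)-(z,y,x).$$ Free non-associative algebra. Let $X=\{x_i\mid i\in I\}$ be a set indexed by a well-ordered set $I$. $X^{**}$ is the set of all non-associative words (fully bracketed nonempty words) in $X$, i.e. the free magma on $X$; $|(u)|$ is the number of letters of $(u)$. $M(X)$ is the $k$-vector space with basis $X^{**}$ and multiplication extending $(u)(v)=((u)(v))$ bilinearly (the free non-associative, non-unital algebra on $X$). $X^*$ is the set of associative words in $X$, including the empty word. Here $X=\{e_i\}_I$. A subword of a non-associative word means a sub-bracketing: $(u)$ is a subword of itself, and the subwords of $(u_1)$ and of $(u_2)$ are subwords of $((u_1)(u_2))$. Deg-lex ordering on $X^{**}$: letters are ordered by $x_i>x_j$ iff $i>j$; otherwise $(u)>(v)$ iff either $|(u)|>|(v)|$, or $|(u)|=|(v)|$, $(u)=((u_1)(u_2))$, $(v)=((v_1)(v_2))$ and either $(u_1)>(v_1)$, or $(u_1)=(v_1)$ and $(u_2)>(v_2)$.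 This is a well ordering compatible with left and right multiplication. For nonzero $f\in M(X)$, $(\bar f)$ denotes its largest word occurring with nonzero coefficient (leading word); $f$ is monic if that coefficient is $1$. $S$-words. Let $S\subset M(X)$ be a set of monic polynomials. $S$-words are defined inductively: each $s\in S$ is an $S$-word; if $p$ is an $S$-word and $(v)\in X^{**}$ then $p(v)$ and $(v)p$ are $S$-words. An $S$-word built from $s$ is written $(asb)$, where $a,b\in X^*$ are the letters to the left and right of $s$ (with the bracketing understood); $(a\bar s b)$ denotes the word obtained by replacing $s$ by $(\bar s)$ in it, and it is the leading word of $(asb)$. Compositions. For monic $f,g$ with $(\bar f)=(a(\bar g)b)$ for some $a,b\in X^*$ (i.e. $(\bar g)$ is a subword of $(\bar f)$ at a given position), the composition of inclusion is $(f,g)_{(\bar f)}=f-(agb)$. It is trivial modulo $(S,(\bar f))$ if it equals a finite sum $\sum_i\alpha_i(a_is_ib_i)$ with $\alpha_i\in k$, $s_i\in S$, $(a_is_ib_i)$ $S$-words and $(a_i(\bar s_i)b_i)<(\bar f)$ for all $i$. A nonempty set $S\subset M(X)$ of monic polynomials is a Gröbner-Shirshov basis in $M(X)$ if every composition $(f,g)_{(\bar f)}$ with $f,g\in S$ is trivial modulo $(S,(\bar f))$. *)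

theory Defs
  imports "HOL-Library.Poly_Mapping" "Jordan_Normal_Form.VS_Connect"
begin

locale akivis_algebra = vector_space scale
  for scale :: "'k::field \<Rightarrow> 'a::ab_group_add \<Rightarrow> 'a" +
  fixes bracket :: "'a \<Rightarrow> 'a \<Rightarrow> 'a"
    and triple :: "'a \<Rightarrow> 'a \<Rightarrow> 'a \<Rightarrow> 'a"
  assumes bracket_linear_left: "Vector_Spaces.linear scale scale (\<lambda>x. bracket x y)"
    and bracket_linear_right: "Vector_Spaces.linear scale scale (\<lambda>y. bracket x y)"
    and triple_linear_1: "Vector_Spaces.linear scale scale (\<lambda>x. triple x y z)"
    and triple_linear_2: "Vector_Spaces.linear scale scale (\<lambda>y. triple x y z)"
    and triple_linear_3: "Vector_Spaces.linear scale scale (\<lambda>z. triple x y z)"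
    and bracket_self: "bracket x x = 0"
    and akivis_identity:
      "bracket (bracket x y) z + bracket (bracket y z) x + bracket (bracket z x) y =
       triple x y z + triple z x y + triple y z x
       - triple x z y - triple y x z - triple z y x"

definition is_basis ::
  "('k::field \<Rightarrow> 'a::ab_group_add \<Rightarrow> 'a) \<Rightarrow> ('i \<Rightarrow> 'a) \<Rightarrow> bool" where
  "is_basis scale e \<longleftrightarrow>
     inj e \<and> \<not> Modules.module.dependent scale (range e) \<and>
     Modules.module.span scale (range e) = UNIV"


datatype 'x nword = Letter 'x | Node "'x nword" "'x nword"

primrec nlength :: "'x nword \<Rightarrow> nat" where
  "nlength (Letter x) = 1"
| "nlength (Node u v) = nlength u + nlength v"

primrec subwords :: "'x nword \<Rightarrow> 'x nword set" where
  "subwords (Letter x) = {Letter x}"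
| "subwords (Node u v) = insert (Node u v) (subwords u \<union> subwords v)"

text \<open>A letter is shorter than any compound word, so length is compared explicitly only
  between two compound words.\<close>

fun deglex_less :: "'x::linorder nword \<Rightarrow> 'x nword \<Rightarrow> bool" where
  "deglex_less (Letter i) (Letter j) \<longleftrightarrow> i < j"
| "deglex_less (Letter i) (Node v1 v2) \<longleftrightarrow> True"
| "deglex_less (Node u1 u2) (Letter j) \<longleftrightarrow> False"
| "deglex_less (Node u1 u2) (Node v1 v2) \<longleftrightarrow>
     nlength (Node u1 u2) < nlength (Node v1 v2) \<or>
     nlength (Node u1 u2) = nlength (Node v1 v2) \<and>
       (deglex_less u1 v1 \<or> u1 = v1 \<and> deglex_less u2 v2)"

lemma deglex_irrefl: "\<not> deglex_less u u"
  by (induction u) auto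

lemma deglex_total: "u \<noteq> v \<Longrightarrow> deglex_less u v \<or> deglex_less v u"
  by (induction u v rule: deglex_less.induct) (auto simp: neq_iff)

lemma deglex_trans: "deglex_less u v \<Longrightarrow> deglex_less v w \<Longrightarrow> deglex_less u w"
proof (induction u v arbitrary: w rule: deglex_less.induct)
  case (1 i j) then show ?case by (cases w) auto
next
  case (2 i v1 v2) then show ?case by (cases w) auto
next
  case (3 u1 u2 j) then show ?case by simp
next
  case (4 u1 u2 v1 v2)
  show ?case
  proof (cases w)
    case (Letter x)
    with "4.prems" show ?thesis by simp
  next
    case (Node w1 w2)
    with "4.prems" "4.IH"(1)[of w1] "4.IH"(2)[of w2] show ?thesis by auto
  qed
qed

instantiation nword :: (linorder) linorder
begin

definition less_nword_def: "u < v \<longleftrightarrow> deglex_less u v"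
definition less_eq_nword_def: "u \<le> v \<longleftrightarrow> u = v \<or> deglex_less u v"

instance
  by standard
    (auto simp: less_nword_def less_eq_nword_def
       dest: deglex_trans deglex_total deglex_irrefl[THEN notE, OF deglex_trans])

end


text \<open>The free algebra on the letters \<open>'x\<close> consists of the finitely supported functions from
  words to the field. The product that \<^theory>\<open>HOL-Library.Poly_Mapping\<close> provides needs an
  associative operation on the exponents, so the product is defined here.\<close>

type_synonym ('x, 'k) nalg = "'x nword \<Rightarrow>\<^sub>0 'k"

definition nmult :: "('x, 'k::field) nalg \<Rightarrow> ('x, 'k) nalg \<Rightarrow> ('x, 'k) nalg"
  (infixl \<open>\<bullet>\<^sub>n\<close> 70) where
  "f \<bullet>\<^sub>n g =
     (\<Sum>u\<in>Poly_Mapping.keys f. \<Sum>v\<in>Poly_Mapping.keys g.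
        Poly_Mapping.single (Node u v) (Poly_Mapping.lookup f u * Poly_Mapping.lookup g v))"

definition nsmult :: "'k::field \<Rightarrow> ('x, 'k) nalg \<Rightarrow> ('x, 'k) nalg" (infixr \<open>*\<^sub>n\<close> 75) where
  "c *\<^sub>n f = Poly_Mapping.map ((*) c) f"

definition word :: "'x nword \<Rightarrow> ('x, 'k::field) nalg" where
  "word w = Poly_Mapping.single w 1"

definition gen :: "'x \<Rightarrow> ('x, 'k::field) nalg" where
  "gen x = word (Letter x)"

definition lead :: "('x::linorder, 'k::field) nalg \<Rightarrow> 'x nword" where
  "lead f = Max (Poly_Mapping.keys f)"

definition monic :: "('x::linorder, 'k::field) nalg \<Rightarrow> bool" where
  "monic f \<longleftrightarrow> f \<noteq> 0 \<and> Poly_Mapping.lookup f (lead f) = 1"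


text \<open>\<open>s_word S p w\<close>: the polynomial \<open>p\<close> is an \<open>S\<close>-word \<open>(a s b)\<close> and \<open>w\<close> is the word
  obtained from it by replacing \<open>s\<close> by its leading word.\<close>

inductive s_word ::
  "('x::linorder, 'k::field) nalg set \<Rightarrow> ('x, 'k) nalg \<Rightarrow> 'x nword \<Rightarrow> bool"
  for S where
  base: "s \<in> S \<Longrightarrow> s_word S s (lead s)"
| right: "s_word S p w \<Longrightarrow> s_word S (p \<bullet>\<^sub>n word v) (Node w v)"
| left: "s_word S p w \<Longrightarrow> s_word S (word v \<bullet>\<^sub>n p) (Node v w)"

definition trivial_mod ::
  "('x::linorder, 'k::field) nalg set \<Rightarrow> 'x nword \<Rightarrow> ('x, 'k) nalg \<Rightarrow> bool" where
  "trivial_mod S w h \<longleftrightarrow>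
     (\<exists>(n::nat) c p v.
        (\<forall>i<n. s_word S (p i) (v i) \<and> v i < w) \<and> h = (\<Sum>i<n. c i *\<^sub>n p i))"

text \<open>An occurrence of the leading word of \<open>g\<close> in that of \<open>f\<close> amounts to a \<open>{g}\<close>-word
  \<open>(a g b)\<close> whose leading word is \<open>lead f\<close>; each occurrence gives one composition.\<close>

definition compositions ::
  "('x::linorder, 'k::field) nalg \<Rightarrow> ('x, 'k) nalg \<Rightarrow> ('x, 'k) nalg set" where
  "compositions f g = {f - p | p. s_word {g} p (lead f)}"

definition groebner_shirshov_basis :: "('x::linorder, 'k::field) nalg set \<Rightarrow> bool" where
  "groebner_shirshov_basis S \<longleftrightarrow>
     S \<noteq> {} \<and> (\<forall>s\<in>S. monic s) \<and>
     (\<forall>f\<in>S. \<forall>g\<in>S. \<forall>h\<in>compositions f g. trivial_mod S (lead f) h)"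


definition two_sided_ideal :: "('x, 'k::field) nalg set \<Rightarrow> bool" where
  "two_sided_ideal J \<longleftrightarrow>
     0 \<in> J \<and> (\<forall>f\<in>J. \<forall>g\<in>J. f + g \<in> J) \<and> (\<forall>c. \<forall>f\<in>J. c *\<^sub>n f \<in> J) \<and>
     (\<forall>f\<in>J. \<forall>g. f \<bullet>\<^sub>n g \<in> J \<and> g \<bullet>\<^sub>n f \<in> J)"

definition coset :: "('x, 'k::field) nalg set \<Rightarrow> ('x, 'k) nalg \<Rightarrow> ('x, 'k) nalg set" where
  "coset J f = {g. g - f \<in> J}"

text \<open>The record type of modules is also that of rings, hence the field \<open>one\<close>; the algebra has
  no unit and this field is left undefined.\<close>

definition quot_alg ::
  "('x, 'k::field) nalg set \<Rightarrow> ('k, ('x, 'k) nalg set) module" where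
  "quot_alg J =
     \<lparr>carrier = range (coset J),
      mult = (\<lambda>P Q. \<Union>p\<in>P. \<Union>q\<in>Q. coset J (p \<bullet>\<^sub>n q)),
      one = undefined,
      zero = J,
      add = (\<lambda>P Q. {p + q | p q. p \<in> P \<and> q \<in> Q}),
      smult = (\<lambda>c P. \<Union>p\<in>P. coset J (c *\<^sub>n p))\<rparr>"


text \<open>\<open>\<alpha> i j\<close> and \<open>\<beta> i j l\<close> are the coordinate vectors of \<open>[e\<^sub>i,e\<^sub>j]\<close> and \<open>(e\<^sub>i,e\<^sub>j,e\<^sub>l)\<close>, so that
  \<open>linear_elt (\<alpha> i j)\<close> is \<open>{e\<^sub>ie\<^sub>j}\<close> and \<open>linear_elt (\<beta> i j l)\<close> is \<open>{e\<^sub>ie\<^sub>je\<^sub>l}\<close>.\<close>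

definition linear_elt :: "('i \<Rightarrow>\<^sub>0 'k::field) \<Rightarrow> ('i, 'k) nalg" where
  "linear_elt a = (\<Sum>m\<in>Poly_Mapping.keys a. Poly_Mapping.lookup a m *\<^sub>n gen m)"

definition rel_f ::
  "('i \<Rightarrow> 'i \<Rightarrow> 'i \<Rightarrow>\<^sub>0 'k::field) \<Rightarrow> 'i \<Rightarrow> 'i \<Rightarrow> ('i, 'k) nalg" where
  "rel_f \<alpha> i j = gen i \<bullet>\<^sub>n gen j - gen j \<bullet>\<^sub>n gen i - linear_elt (\<alpha> i j)"

definition rel_g ::
  "('i \<Rightarrow> 'i \<Rightarrow> 'i \<Rightarrow> 'i \<Rightarrow>\<^sub>0 'k::field) \<Rightarrow> 'i \<Rightarrow> 'i \<Rightarrow> 'i \<Rightarrow> ('i, 'k) nalg" where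
  "rel_g \<beta> i j l =
     (gen i \<bullet>\<^sub>n gen j) \<bullet>\<^sub>n gen l - gen i \<bullet>\<^sub>n (gen j \<bullet>\<^sub>n gen l) - linear_elt (\<beta> i j l)"

definition rel_h ::
  "('i \<Rightarrow> 'i \<Rightarrow> 'i \<Rightarrow>\<^sub>0 'k::field) \<Rightarrow> ('i \<Rightarrow> 'i \<Rightarrow> 'i \<Rightarrow> 'i \<Rightarrow>\<^sub>0 'k) \<Rightarrow>
   'i \<Rightarrow> 'i \<Rightarrow> 'i \<Rightarrow> ('i, 'k) nalg" where
  "rel_h \<alpha> \<beta> i j l =
     gen i \<bullet>\<^sub>n (gen j \<bullet>\<^sub>n gen l) - gen j \<bullet>\<^sub>n (gen i \<bullet>\<^sub>n gen l)
     - linear_elt (\<alpha> i j) \<bullet>\<^sub>n gen l - linear_elt (\<beta> j i l) + linear_elt (\<beta> i j l)"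

definition env_ideal ::
  "('i \<Rightarrow> 'i \<Rightarrow> 'i \<Rightarrow>\<^sub>0 'k::field) \<Rightarrow> ('i \<Rightarrow> 'i \<Rightarrow> 'i \<Rightarrow> 'i \<Rightarrow>\<^sub>0 'k) \<Rightarrow> ('i, 'k) nalg set" where
  "env_ideal \<alpha> \<beta> =
     two_sided_ideal hull ({rel_f \<alpha> i j | i j. True} \<union> {rel_g \<beta> i j l | i j l. True})"

definition env_alg ::
  "('i \<Rightarrow> 'i \<Rightarrow> 'i \<Rightarrow>\<^sub>0 'k::field) \<Rightarrow> ('i \<Rightarrow> 'i \<Rightarrow> 'i \<Rightarrow> 'i \<Rightarrow>\<^sub>0 'k) \<Rightarrow>
   ('k, ('i, 'k) nalg set) module" where
  "env_alg \<alpha> \<beta> = quot_alg (env_ideal \<alpha> \<beta>)"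

definition env_class ::
  "('i \<Rightarrow> 'i \<Rightarrow> 'i \<Rightarrow>\<^sub>0 'k::field) \<Rightarrow> ('i \<Rightarrow> 'i \<Rightarrow> 'i \<Rightarrow> 'i \<Rightarrow>\<^sub>0 'k) \<Rightarrow>
   ('i, 'k) nalg \<Rightarrow> ('i, 'k) nalg set" where
  "env_class \<alpha> \<beta> = coset (env_ideal \<alpha> \<beta>)"

definition gs_set ::
  "('i::linorder \<Rightarrow> 'i \<Rightarrow> 'i \<Rightarrow>\<^sub>0 'k::field) \<Rightarrow> ('i \<Rightarrow> 'i \<Rightarrow> 'i \<Rightarrow> 'i \<Rightarrow>\<^sub>0 'k) \<Rightarrow>
   ('i, 'k) nalg set" where
  "gs_set \<alpha> \<beta> =
     {rel_f \<alpha> i j | i j. i > j} \<union>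
     {rel_g \<beta> i j l | i j l. True} \<union>
     {rel_h \<alpha> \<beta> i j l | i j l. i > j \<and> l \<ge> j}"

definition irr_words :: "'i::linorder nword set" where
  "irr_words = {u.
     (\<forall>i j. i > j \<longrightarrow> Node (Letter i) (Letter j) \<notin> subwords u) \<and>
     (\<forall>i j l. Node (Node (Letter i) (Letter j)) (Letter l) \<notin> subwords u) \<and>
     (\<forall>i j l. i > j \<and> l \<ge> j \<longrightarrow>
        Node (Letter i) (Node (Letter j) (Letter l)) \<notin> subwords u)}"


lemma lookup_nsmult [simp]:
  "Poly_Mapping.lookup (c *\<^sub>n f) w = c * Poly_Mapping.lookup f w"
  by (simp add: nsmult_def Poly_Mapping.map.rep_eq when_def)

lemma nsmult_simps:
  "(a * b) *\<^sub>n f = a *\<^sub>n b *\<^sub>n f" "1 *\<^sub>n f = f"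
  "(a + b) *\<^sub>n f = a *\<^sub>n f + b *\<^sub>n f" "a *\<^sub>n (f + g) = a *\<^sub>n f + a *\<^sub>n g"
  "a *\<^sub>n (f - g) = a *\<^sub>n f - a *\<^sub>n g" "(- 1) *\<^sub>n f = - f"
  by (rule poly_mapping_eqI; simp add: lookup_add lookup_minus algebra_simps)+

lemma nmult_extend:
  assumes "finite A" "Poly_Mapping.keys f \<subseteq> A" "finite B" "Poly_Mapping.keys g \<subseteq> B"
  shows "f \<bullet>\<^sub>n g = (\<Sum>u\<in>A. \<Sum>v\<in>B.
    Poly_Mapping.single (Node u v) (Poly_Mapping.lookup f u * Poly_Mapping.lookup g v))"
proof -
  have "(\<Sum>v\<in>Poly_Mapping.keys g.
          Poly_Mapping.single (Node u v) (Poly_Mapping.lookup f u * Poly_Mapping.lookup g v)) =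
        (\<Sum>v\<in>B.
          Poly_Mapping.single (Node u v) (Poly_Mapping.lookup f u * Poly_Mapping.lookup g v))" for u
    using assms by (intro sum.mono_neutral_left) (auto simp: in_keys_iff)
  then show ?thesis
    unfolding nmult_def using assms
    by (simp, intro sum.mono_neutral_left) (auto simp: in_keys_iff)
qed

lemma nmult_diff_left: "(f - f') \<bullet>\<^sub>n g = f \<bullet>\<^sub>n g - f' \<bullet>\<^sub>n g"
proof -
  let ?A = "Poly_Mapping.keys f \<union> Poly_Mapping.keys f'" and ?B = "Poly_Mapping.keys g"
  have "Poly_Mapping.keys (f - f') \<subseteq> ?A"
    by (auto simp: in_keys_iff lookup_minus)
  then show ?thesis
    by (subst (1 2 3) nmult_extend[of ?A _ ?B])
      (auto simp: lookup_minus left_diff_distrib single_diff sum_subtractf)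
qed

lemma nmult_diff_right: "f \<bullet>\<^sub>n (g - g') = f \<bullet>\<^sub>n g - f \<bullet>\<^sub>n g'"
proof -
  let ?A = "Poly_Mapping.keys f" and ?B = "Poly_Mapping.keys g \<union> Poly_Mapping.keys g'"
  have "Poly_Mapping.keys (g - g') \<subseteq> ?B"
    by (auto simp: in_keys_iff lookup_minus)
  then show ?thesis
    by (subst (1 2 3) nmult_extend[of ?A _ ?B])
      (auto simp: lookup_minus right_diff_distrib single_diff sum_subtractf)
qed

lemma two_sided_ideal_hull: "two_sided_ideal (two_sided_ideal hull G)"
  by (rule hull_in) (auto simp: two_sided_ideal_def)

context
  fixes J :: "('x, 'k::field) nalg set"
  assumes J: "two_sided_ideal J"
begin

private lemma J_add: "f \<in> J \<Longrightarrow> g \<in> J \<Longrightarrow> f + g \<in> J"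
  and J_smult: "f \<in> J \<Longrightarrow> c *\<^sub>n f \<in> J"
  and J_zero: "0 \<in> J"
  using J by (auto simp: two_sided_ideal_def)

private lemma J_minus: "f \<in> J \<Longrightarrow> - f \<in> J"
  using J_smult[of f "- 1"] by (simp add: nsmult_simps)

lemma coset_eq_iff: "coset J f = coset J g \<longleftrightarrow> f - g \<in> J"
proof
  assume "coset J f = coset J g"
  moreover have "f \<in> coset J f" by (simp add: coset_def J_zero)
  ultimately show "f - g \<in> J" by (auto simp: coset_def)
next
  assume *: "f - g \<in> J"
  have "h - g \<in> J" if "h - f \<in> J" for h using J_add[OF that *] by simp
  moreover have "h - f \<in> J" if "h - g \<in> J" for h
    using J_add[OF that J_minus[OF *]] by simp
  ultimately show "coset J f = coset J g" by (auto simp: coset_def)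
qed

lemma self_in_coset: "f \<in> coset J f"
  by (simp add: coset_def J_zero)

lemma quot_alg_ops:
  "carrier (quot_alg J) = range (coset J)"
  "\<zero>\<^bsub>quot_alg J\<^esub> = coset J 0"
  "coset J f \<oplus>\<^bsub>quot_alg J\<^esub> coset J g = coset J (f + g)"
  "c \<odot>\<^bsub>quot_alg J\<^esub> coset J f = coset J (c *\<^sub>n f)"
  "coset J f \<otimes>\<^bsub>quot_alg J\<^esub> coset J g = coset J (f \<bullet>\<^sub>n g)"
proof -
  show "carrier (quot_alg J) = range (coset J)" "\<zero>\<^bsub>quot_alg J\<^esub> = coset J 0"
    by (auto simp: quot_alg_def coset_def)
  show "coset J f \<oplus>\<^bsub>quot_alg J\<^esub> coset J g = coset J (f + g)"
  proof (intro equalityI subsetI)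
    fix h assume "h \<in> coset J f \<oplus>\<^bsub>quot_alg J\<^esub> coset J g"
    then obtain p q where "h = p + q" "p - f \<in> J" "q - g \<in> J"
      by (auto simp: quot_alg_def coset_def)
    then show "h \<in> coset J (f + g)"
      using J_add[of "p - f" "q - g"] by (simp add: coset_def algebra_simps)
  next
    fix h assume "h \<in> coset J (f + g)"
    then have *: "(h - f) - g \<in> J"
      by (simp add: coset_def algebra_simps)
    show "h \<in> coset J f \<oplus>\<^bsub>quot_alg J\<^esub> coset J g"
    proof -
      have "h = f + (h - f) \<and> f \<in> coset J f \<and> h - f \<in> coset J g"
        using * J_zero by (simp add: coset_def)
      then have "\<exists>p q. h = p + q \<and> p \<in> coset J f \<and> q \<in> coset J g" by blast
      then show ?thesis by (simp add: quot_alg_def)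
    qed
  qed
  have "coset J (c *\<^sub>n p) = coset J (c *\<^sub>n f)" if "p \<in> coset J f" for p
    using that J_smult[of "p - f" c]
    unfolding coset_eq_iff by (simp add: coset_def nsmult_simps)
  then have "(\<Union>p\<in>coset J f. coset J (c *\<^sub>n p)) = coset J (c *\<^sub>n f)"
    using self_in_coset[of f] by blast
  then show "c \<odot>\<^bsub>quot_alg J\<^esub> coset J f = coset J (c *\<^sub>n f)"
    by (simp add: quot_alg_def)
  have "coset J (p \<bullet>\<^sub>n q) = coset J (f \<bullet>\<^sub>n g)" if "p \<in> coset J f" "q \<in> coset J g" for p q
  proof -
    have "(p - f) \<bullet>\<^sub>n q \<in> J" "f \<bullet>\<^sub>n (q - g) \<in> J"
      using that J by (auto simp: coset_def two_sided_ideal_def)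
    from J_add[OF this] show ?thesis
      unfolding coset_eq_iff by (simp add: nmult_diff_left nmult_diff_right)
  qed
  then have "(\<Union>p\<in>coset J f. \<Union>q\<in>coset J g. coset J (p \<bullet>\<^sub>n q)) = coset J (f \<bullet>\<^sub>n g)"
    using self_in_coset[of f] self_in_coset[of g] by blast
  then show "coset J f \<otimes>\<^bsub>quot_alg J\<^esub> coset J g = coset J (f \<bullet>\<^sub>n g)"
    by (simp add: quot_alg_def)
qed

lemma vectorspace_quot_alg: "vectorspace class_ring (quot_alg J)"
proof (rule vs_criteria)
  show "field (class_ring :: 'k ring)" by (rule class_field)
  show "\<forall>v\<in>carrier (quot_alg J).
      \<exists>neg_v\<in>carrier (quot_alg J). v \<oplus>\<^bsub>quot_alg J\<^esub> neg_v = \<zero>\<^bsub>quot_alg J\<^esub>"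
  proof
    fix v assume "v \<in> carrier (quot_alg J)"
    then obtain f where "v = coset J f" by (auto simp: quot_alg_ops)
    then show "\<exists>neg_v\<in>carrier (quot_alg J). v \<oplus>\<^bsub>quot_alg J\<^esub> neg_v = \<zero>\<^bsub>quot_alg J\<^esub>"
      by (intro bexI[of _ "coset J (- f)"]) (auto simp: quot_alg_ops)
  qed
qed (auto simp: quot_alg_ops nsmult_simps ac_simps)

end

lemma vectorspace_env_alg: "vectorspace class_ring (env_alg \<alpha> \<beta>)"
  unfolding env_alg_def env_ideal_def by (rule vectorspace_quot_alg[OF two_sided_ideal_hull])

end

theory Submission
  imports Defs
begin

text \<open>Two \<open>S\<close>-words with the same leading word \<open>w\<close> differ by a combination of \<open>S\<close>-words with
  smaller leading words: if the occurrences of the leading words of the two elements of \<open>S\<close> are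
  nested this is the triviality of a composition multiplied by words, and if they are disjoint it
  follows by replacing one factor after the other. Hence one \<open>S\<close>-word for each reducible word
  spans the ideal, and these have distinct leading words, so that no nonzero element of the ideal
  is a combination of irreducible words; rewriting shows that the irreducible words span the quotient.

  For the enveloping algebra the only composition that does not vanish is that of \<open>f\<^sub>i\<^sub>j\<close> in
  \<open>g\<^sub>i\<^sub>j\<^sub>l\<close>. If \<open>l \<ge> j\<close> it is a combination of \<open>g\<^sub>j\<^sub>i\<^sub>l\<close> and \<open>h\<^sub>i\<^sub>j\<^sub>l\<close>, and if \<open>l < j\<close> it reduces to
  zero by the Akivis identity for \<open>e\<^sub>i\<close>, \<open>e\<^sub>j\<close> and \<open>e\<^sub>l\<close>. Letters are irreducible, so \<open>A\<close> embeds.\<close>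

subsection \<open>The free non-associative algebra\<close>

interpretation nalg: vector_space "nsmult :: 'k::field \<Rightarrow> ('x, 'k) nalg \<Rightarrow> ('x, 'k) nalg"
  by unfold_locales (simp_all add: nsmult_simps)

lemma nmult_zero_left [simp]: "0 \<bullet>\<^sub>n g = 0"
  using nmult_diff_left[of 0 0 g] by simp

lemma nmult_zero_right [simp]: "f \<bullet>\<^sub>n 0 = 0"
  using nmult_diff_right[of f 0 0] by simp

lemma nmult_minus_left: "(- f) \<bullet>\<^sub>n g = - (f \<bullet>\<^sub>n g)"
  using nmult_diff_left[of 0 f g] by simp

lemma nmult_minus_right: "f \<bullet>\<^sub>n (- g) = - (f \<bullet>\<^sub>n g)"
  using nmult_diff_right[of f 0 g] by simp

lemma nmult_add_left: "(f + f') \<bullet>\<^sub>n g = f \<bullet>\<^sub>n g + f' \<bullet>\<^sub>n g"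
  using nmult_diff_left[of f "- f'" g] by (simp add: nmult_minus_left)

lemma nmult_add_right: "f \<bullet>\<^sub>n (g + g') = f \<bullet>\<^sub>n g + f \<bullet>\<^sub>n g'"
  using nmult_diff_right[of f g "- g'"] by (simp add: nmult_minus_right)

lemma nsmult_single: "c *\<^sub>n Poly_Mapping.single w a = Poly_Mapping.single w (c * a)"
  by (rule poly_mapping_eqI) (simp add: lookup_single when_def)

lemma nmult_smult_left: "(c *\<^sub>n f) \<bullet>\<^sub>n g = c *\<^sub>n (f \<bullet>\<^sub>n g)"
proof -
  have "Poly_Mapping.keys (c *\<^sub>n f) \<subseteq> Poly_Mapping.keys f"
    by (auto simp: in_keys_iff)
  then show ?thesis
    by (subst (1 2) nmult_extend[of "Poly_Mapping.keys f" _ "Poly_Mapping.keys g"])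
      (auto simp: nalg.scale_sum_right nsmult_single mult.assoc)
qed

lemma nmult_smult_right: "f \<bullet>\<^sub>n (c *\<^sub>n g) = c *\<^sub>n (f \<bullet>\<^sub>n g)"
proof -
  have "Poly_Mapping.keys (c *\<^sub>n g) \<subseteq> Poly_Mapping.keys g"
    by (auto simp: in_keys_iff)
  then show ?thesis
    by (subst (1 2) nmult_extend[of "Poly_Mapping.keys f" _ "Poly_Mapping.keys g"])
      (auto simp: nalg.scale_sum_right nsmult_single mult.left_commute)
qed

lemmas nmult_linear =
  nmult_add_left nmult_add_right nmult_diff_left nmult_diff_right
  nmult_minus_left nmult_minus_right nmult_smult_left nmult_smult_right

lemma word_mult: "word u \<bullet>\<^sub>n word v = word (Node u v)"
  by (simp add: nmult_def word_def)

text \<open>For fixed \<open>g\<close> the left factors whose product lies in \<open>T\<close> form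
  a subspace, so a spanning set is enough. This stands in for bilinear expansions in later
  arguments.\<close>

lemma nmult_span_left:
  assumes "f \<in> nalg.span B" "nalg.subspace T" "\<And>b. b \<in> B \<Longrightarrow> b \<bullet>\<^sub>n g \<in> T"
  shows "f \<bullet>\<^sub>n g \<in> T"
proof -
  have "nalg.span B \<subseteq> {f. f \<bullet>\<^sub>n g \<in> T}"
    using assms(2,3) by (intro nalg.span_minimal) (auto simp: nalg.subspace_def nmult_linear)
  then show ?thesis using assms(1) by blast
qed

lemma nmult_span_right:
  assumes "g \<in> nalg.span B" "nalg.subspace T" "\<And>b. b \<in> B \<Longrightarrow> f \<bullet>\<^sub>n b \<in> T"
  shows "f \<bullet>\<^sub>n g \<in> T"
proof -
  have "nalg.span B \<subseteq> {g. f \<bullet>\<^sub>n g \<in> T}"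
    using assms(2,3) by (intro nalg.span_minimal) (auto simp: nalg.subspace_def nmult_linear)
  then show ?thesis using assms(1) by blast
qed

lemma lookup_word: "Poly_Mapping.lookup (word w) u = (if u = w then 1 else 0)"
  by (simp add: word_def lookup_single when_def)

lemma lookup_sum_pm: "Poly_Mapping.lookup (\<Sum>a\<in>A. f a) u = (\<Sum>a\<in>A. Poly_Mapping.lookup (f a) u)"
  by (induction A rule: infinite_finite_induct) (simp_all add: lookup_add)

lemma nalg_expansion:
  "f = (\<Sum>u\<in>Poly_Mapping.keys f. Poly_Mapping.lookup f u *\<^sub>n word u)"
  by (rule poly_mapping_eqI)
    (auto simp: lookup_sum_pm lookup_word in_keys_iff if_distrib cong: if_cong)

lemma in_span_keys: "f \<in> nalg.span (word ` Poly_Mapping.keys f)"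
  by (subst nalg_expansion) (intro nalg.span_sum nalg.span_scale nalg.span_base imageI)

lemma in_span_words: "f \<in> nalg.span (range word)"
  using in_span_keys nalg.span_mono[of "word ` Poly_Mapping.keys f" "range word"] by blast

lemma span_words_lookup:
  assumes "f \<in> nalg.span (word ` U)" "u \<notin> U"
  shows "Poly_Mapping.lookup f u = 0"
proof -
  have "nalg.span (word ` U) \<subseteq> {f. Poly_Mapping.lookup f u = 0}"
    using assms(2) by (intro nalg.span_minimal)
      (auto simp: nalg.subspace_def lookup_add lookup_word)
  then show ?thesis using assms(1) by blast
qed

lemma linear_elt_in_span: "linear_elt a \<in> nalg.span (range gen)"
  unfolding linear_elt_def by (intro nalg.span_sum nalg.span_scale nalg.span_base) auto


subsection \<open>Leading words\<close>

text \<open>Induction on the length. At a fixed length the order on compound words is lexicographic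
  in the two factors, both of which are shorter, so accessibility follows by induction on the left
  factor with one on the right factor inside it. Letters inherit the well-order of the index
  type.\<close>

instance nword :: (wellorder) wellorder
proof (rule wf_wellorderI)
  have acc_Node: "Wellfounded.accp (<) (Node u v)"
    if shorter: "\<And>w :: 'a nword. nlength w < n \<Longrightarrow> Wellfounded.accp (<) w"
      and n: "nlength u + nlength v = n" for u v :: "'a nword" and n
  proof -
    have pos: "0 < nlength w" for w :: "'a nword" by (induction w) auto
    have "Wellfounded.accp (<) u" using shorter n pos[of v] by simp
    then show ?thesis using n
    proof (induction u arbitrary: v rule: accp_induct_rule)
      case IHu: (1 u)
      have "Wellfounded.accp (<) v" using shorter IHu.prems pos[of u] by simp
      then show ?case using IHu.prems
      proof (induction v rule: accp_induct_rule)
        case IHv: (1 v)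
        show ?case
        proof (rule accpI)
          fix w assume w: "w < Node u v"
          show "Wellfounded.accp (<) w"
          proof (cases w)
            case (Letter x)
            have "1 < n" using IHv.prems pos[of u] pos[of v] by linarith
            then show ?thesis using Letter by (intro shorter) simp
          next
            case (Node w1 w2)
            then consider "nlength w < n"
              | "nlength w1 + nlength w2 = n" "w1 < u"
              | "nlength w1 + nlength w2 = n" "w1 = u" "w2 < v"
              using w IHv.prems by (auto simp: less_nword_def)
            then show ?thesis
              using IHv.IH IHu.IH Node shorter by cases auto
          qed
        qed
      qed
    qed
  qed
  have "Wellfounded.accp (<) w" if "nlength w = n" for w :: "'a nword" and n
    using that
  proof (induction n arbitrary: w rule: less_induct)
    case (less n)
    show ?case
    proof (cases w)
      case (Letter x)
      have "Wellfounded.accp (<) (Letter x)"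
      proof (induction x rule: less_induct)
        case (less x)
        show ?case
        proof (rule accpI)
          fix w assume "w < Letter x"
          then obtain y where "w = Letter y" "y < x"
            by (cases w) (auto simp: less_nword_def)
          then show "Wellfounded.accp (<) w" using less by simp
        qed
      qed
      then show ?thesis using Letter by simp
    next
      case (Node u v)
      then show ?thesis using less acc_Node[of n u v] by auto
    qed
  qed
  then show "wf {(u :: 'a nword, v). u < v}"
    unfolding wfp_def[symmetric] by (blast intro: accp_wfpI)
qed intro_classes

lemma nlength_neq_0 [simp]: "nlength w \<noteq> 0"
  by (induction w) auto

lemma nlength_mono: "nlength u < nlength v \<Longrightarrow> u < v"
  by (cases u; cases v) (auto simp: less_nword_def)

lemma deglex_nlength: "u < v \<Longrightarrow> nlength u \<le> nlength v"
  using nlength_mono[of v u] by (meson less_asym not_le)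

text \<open>Deg-lex compares total lengths first, so it matters that the smaller factor is never the
  longer one.\<close>

lemma Node_less_left: "u < u' \<Longrightarrow> Node u v < Node u' v"
  using deglex_nlength[of u u'] by (auto simp: less_nword_def)

lemma Node_less_right: "v < v' \<Longrightarrow> Node u v < Node u v'"
  using deglex_nlength[of v v'] by (auto simp: less_nword_def)

text \<open>The condition \<open>f - word w \<in> below w\<close> says that \<open>f\<close> is
  monic with leading word \<open>w\<close>. As a span, the set lets such conditions be proved by
  linearity instead of through \<open>Max\<close> of the support.\<close>

definition below :: "'x::linorder nword \<Rightarrow> ('x, 'k::field) nalg set" where
  "below w = nalg.span (word ` {..<w})"

lemma subspace_below: "nalg.subspace (below w)"
  by (simp add: below_def)

lemma word_in_below: "u < w \<Longrightarrow> word u \<in> below w"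
  unfolding below_def by (rule nalg.span_base) simp

lemma below_lookup: "f \<in> below w \<Longrightarrow> \<not> u < w \<Longrightarrow> Poly_Mapping.lookup f u = 0"
  unfolding below_def using span_words_lookup[of f "{..<w}" u] by simp

lemma below_mult_right: "f \<in> below u \<Longrightarrow> f \<bullet>\<^sub>n word v \<in> below (Node u v)"
  unfolding below_def by (erule nmult_span_left)
    (auto simp: word_mult intro!: nalg.span_base Node_less_left)

lemma below_mult_left: "f \<in> below v \<Longrightarrow> word u \<bullet>\<^sub>n f \<in> below (Node u v)"
  unfolding below_def by (erule nmult_span_right)
    (auto simp: word_mult intro!: nalg.span_base Node_less_right)

lemma lead_eqI:
  assumes "f - word w \<in> below w"
  shows "lead f = w" and "Poly_Mapping.lookup f w = 1" and "monic f"
proof -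
  have lookup: "Poly_Mapping.lookup f u = (if u = w then 1 else 0)" if "\<not> u < w" for u
    using below_lookup[OF assms that] by (simp add: lookup_minus lookup_word)
  show f_w: "Poly_Mapping.lookup f w = 1" using lookup[of w] by simp
  show lead: "lead f = w" unfolding lead_def
  proof (rule Max_eqI)
    show "u \<le> w" if "u \<in> Poly_Mapping.keys f" for u
      using that lookup[of u] by (cases "u < w") (auto simp: in_keys_iff split: if_splits)
  qed (simp_all add: in_keys_iff f_w)
  show "monic f" using f_w lead by (auto simp: monic_def)
qed

lemma monic_below:
  assumes "monic f"
  shows "f - word (lead f) \<in> below (lead f)"
proof -
  let ?g = "f - word (lead f)"
  have "Poly_Mapping.keys ?g \<subseteq> {..<lead f}"
  proof
    fix u assume "u \<in> Poly_Mapping.keys ?g"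
    then have "u \<noteq> lead f" "u \<in> Poly_Mapping.keys f"
      using assms by (auto simp: in_keys_iff lookup_minus lookup_word monic_def split: if_splits)
    then show "u \<in> {..<lead f}" by (simp add: lead_def less_le)
  qed
  then show ?thesis unfolding below_def
    using in_span_keys nalg.span_mono[OF image_mono] by blast
qed

text \<open>Among the elements with nonzero coefficient the one with the largest leading word is
  unique by injectivity, and no other element can cancel that word.\<close>

lemma lead_in_span:
  assumes "h \<in> nalg.span B" "h \<noteq> 0" "inj_on lead B" "\<And>b. b \<in> B \<Longrightarrow> monic b"
  shows "\<exists>b\<in>B. Poly_Mapping.lookup h (lead b) \<noteq> 0"
proof -
  obtain t r where t: "finite t" "t \<subseteq> B" "h = (\<Sum>a\<in>t. r a *\<^sub>n a)"
    using assms(1) unfolding nalg.span_explicit by blast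
  define t' where "t' = {a \<in> t. r a \<noteq> 0}"
  have h: "h = (\<Sum>a\<in>t'. r a *\<^sub>n a)"
    unfolding t(3) t'_def using t(1) by (intro sum.mono_neutral_right) auto
  have t': "finite t'" "t' \<subseteq> B" using t by (auto simp: t'_def)
  have "t' \<noteq> {}" using h assms(2) by auto
  then have "Max (lead ` t') \<in> lead ` t'" using t' by (intro Max_in) auto
  then obtain b where b: "b \<in> t'" "lead b = Max (lead ` t')" by force
  have "Poly_Mapping.lookup h (lead b) = (\<Sum>a\<in>t'. r a * Poly_Mapping.lookup a (lead b))"
    by (simp add: h lookup_sum_pm)
  also have "\<dots> = (\<Sum>a\<in>{b}. r a * Poly_Mapping.lookup a (lead b))"
  proof (rule sum.mono_neutral_right)
    show "\<forall>a\<in>t' - {b}. r a * Poly_Mapping.lookup a (lead b) = 0"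
    proof
      fix a assume a: "a \<in> t' - {b}"
      then have "lead a \<le> lead b" using b(2) t' by simp
      moreover have "lead a \<noteq> lead b" using inj_onD[OF assms(3), of a b] a b(1) t'(2) by blast
      ultimately have "\<not> lead b < lead a" "lead b \<noteq> lead a" by auto
      then have "Poly_Mapping.lookup a (lead b) = 0"
        using below_lookup[OF monic_below, of a "lead b"] assms(4) a t'
        by (auto simp: lookup_minus lookup_word)
      then show "r a * Poly_Mapping.lookup a (lead b) = 0" by simp
    qed
  qed (use b t' in auto)
  also have "\<dots> \<noteq> 0"
  proof -
    have "monic b" using b(1) t'(2) assms(4) by blast
    moreover have "r b \<noteq> 0" using b(1) by (simp add: t'_def)
    ultimately show ?thesis by (simp add: monic_def)
  qed
  finally show ?thesis using b(1) t'(2) by blast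
qed


subsection \<open>The composition-diamond lemma\<close>

text \<open>These are the polynomials trivial modulo \<open>(S, w)\<close>, in a form closed under
  linear operations by construction.\<close>

definition lower_span :: "('x::linorder, 'k::field) nalg set \<Rightarrow> 'x nword \<Rightarrow> ('x, 'k) nalg set" where
  "lower_span S w = nalg.span {p. \<exists>v<w. s_word S p v}"

lemma subspace_lower_span: "nalg.subspace (lower_span S w)"
  by (simp add: lower_span_def)

lemma lower_span_base: "s_word S p v \<Longrightarrow> v < w \<Longrightarrow> p \<in> lower_span S w"
  unfolding lower_span_def by (rule nalg.span_base) blast

lemma trivial_mod_iff: "trivial_mod S w h \<longleftrightarrow> h \<in> lower_span S w"
proof
  assume "trivial_mod S w h"
  then obtain n :: nat and c p v
    where "\<forall>i<n. s_word S (p i) (v i) \<and> v i < w" "h = (\<Sum>i<n. c i *\<^sub>n p i)"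
    unfolding trivial_mod_def by blast
  then show "h \<in> lower_span S w"
    by (auto intro!: nalg.subspace_sum nalg.subspace_scale subspace_lower_span intro: lower_span_base)
next
  assume "h \<in> lower_span S w"
  then obtain t r where t: "finite t" "t \<subseteq> {p. \<exists>v<w. s_word S p v}" "h = (\<Sum>a\<in>t. r a *\<^sub>n a)"
    unfolding lower_span_def nalg.span_explicit by blast
  have "\<forall>p\<in>t. \<exists>v. s_word S p v \<and> v < w" using t(2) by blast
  from bchoice[OF this] obtain v where v: "\<forall>p\<in>t. s_word S p (v p) \<and> v p < w" ..
  \<comment> \<open>The finite set \<open>t\<close> is numbered because \<open>trivial_mod\<close>
    asks for a sum over an initial segment of the naturals.\<close>
  obtain p where p: "bij_betw p {..<card t} t"
    using ex_bij_betw_nat_finite[OF t(1)] by (auto simp: atLeast0LessThan)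
  show "trivial_mod S w h" unfolding trivial_mod_def
  proof (intro exI conjI)
    show "\<forall>i<card t. s_word S (p i) (v (p i)) \<and> v (p i) < w"
      using v bij_betwE[OF p] by auto
    show "h = (\<Sum>i<card t. r (p i) *\<^sub>n p i)"
      unfolding t(3) by (rule sum.reindex_bij_betw[OF p, symmetric])
  qed
qed

lemma lower_span_mult_right: "h \<in> lower_span S u \<Longrightarrow> h \<bullet>\<^sub>n word v \<in> lower_span S (Node u v)"
  unfolding lower_span_def by (erule nmult_span_left)
    (blast intro: nalg.subspace_span nalg.span_base s_word.right Node_less_left)+

lemma lower_span_mult_left: "h \<in> lower_span S v \<Longrightarrow> word u \<bullet>\<^sub>n h \<in> lower_span S (Node u v)"
  unfolding lower_span_def by (erule nmult_span_right)
    (blast intro: nalg.subspace_span nalg.span_base s_word.left Node_less_right)+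

text \<open>Deg-lex is compatible with multiplication on both sides, so the word carried along by
  \<open>s_word\<close> really is the leading word.\<close>

lemma s_word_below:
  assumes "s_word S p w" "\<forall>s\<in>S. monic s"
  shows "p - word w \<in> below w"
  using assms(1)
proof induction
  case (base s)
  then show ?case using assms(2) monic_below by blast
next
  case (right p w v)
  have "p \<bullet>\<^sub>n word v - word (Node w v) = (p - word w) \<bullet>\<^sub>n word v"
    by (simp add: nmult_linear word_mult)
  then show ?case using below_mult_right[OF right.IH] by simp
next
  case (left p w v)
  have "word v \<bullet>\<^sub>n p - word (Node v w) = word v \<bullet>\<^sub>n (p - word w)"
    by (simp add: nmult_linear word_mult)
  then show ?case using below_mult_left[OF left.IH] by simp
qed

lemma s_word_single: "s_word S p w \<Longrightarrow> \<exists>s\<in>S. s_word {s} p w"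
  by (induction rule: s_word.induct) (blast intro: s_word.intros)+

text \<open>Induction on the common leading word. If one of the two is an element of
  \<open>S\<close>, the difference is a composition up to sign. If both arise by multiplication on
  the same side, the induction hypothesis is multiplied by a word. If the sides differ, the two
  occurrences are disjoint.\<close>

lemma s_word_diff:
  assumes S: "groebner_shirshov_basis S" and "s_word S p w" "s_word S q w"
  shows "p - q \<in> lower_span S w"
proof -
  have monic: "\<forall>s\<in>S. monic s" using S by (simp add: groebner_shirshov_basis_def)
  have composition: "s - q \<in> lower_span S (lead s)" if "s \<in> S" "s_word S q (lead s)" for s q
    using s_word_single[OF that(2)] that(1) S
    by (auto simp: groebner_shirshov_basis_def compositions_def trivial_mod_iff)
  from assms(2,3) show ?thesis
  proof (induction w arbitrary: p q rule: nword.induct)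
    case (Letter x)
    from Letter.prems(1) obtain "p \<in> S" "lead p = Letter x" by cases auto
    then show ?case using composition Letter.prems(2) by force
  next
    case (Node w1 w2)
    let ?L = "lower_span S (Node w1 w2)"
    \<comment> \<open>\<open>p v - w q = (p - w) q - p (q - v)\<close>, where \<open>w\<close> and \<open>v\<close> are the leading words of \<open>p\<close>
      and \<open>q\<close>: every word of \<open>p - w\<close> is smaller than \<open>w\<close>, and every word of \<open>q - v\<close> than \<open>v\<close>.\<close>
    have disjoint: "p \<bullet>\<^sub>n word w2 - word w1 \<bullet>\<^sub>n q \<in> ?L" if "s_word S p w1" "s_word S q w2" for p q
    proof -
      have "(p - word w1) \<bullet>\<^sub>n q \<in> ?L"
      proof (rule nmult_span_left[OF _ subspace_lower_span])
        show "p - word w1 \<in> nalg.span (word ` {..<w1})"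
          using s_word_below[OF that(1) monic] by (simp add: below_def)
        show "r \<bullet>\<^sub>n q \<in> ?L" if "r \<in> word ` {..<w1}" for r
          using that lower_span_base[OF s_word.left[OF \<open>s_word S q w2\<close>] Node_less_left] by blast
      qed
      moreover have "p \<bullet>\<^sub>n (q - word w2) \<in> ?L"
      proof (rule nmult_span_right[OF _ subspace_lower_span])
        show "q - word w2 \<in> nalg.span (word ` {..<w2})"
          using s_word_below[OF that(2) monic] by (simp add: below_def)
        show "p \<bullet>\<^sub>n r \<in> ?L" if "r \<in> word ` {..<w2}" for r
          using that lower_span_base[OF s_word.right[OF \<open>s_word S p w1\<close>] Node_less_right] by blast
      qed
      ultimately have "(p - word w1) \<bullet>\<^sub>n q - p \<bullet>\<^sub>n (q - word w2) \<in> ?L"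
        by (rule nalg.subspace_diff[OF subspace_lower_span])
      then show ?thesis by (simp add: nmult_linear)
    qed
    have flip: "f - g \<in> ?L \<Longrightarrow> g - f \<in> ?L" for f g
      using nalg.subspace_neg[OF subspace_lower_span, of "f - g" S "Node w1 w2"] by simp
    have diffs: "p' \<bullet>\<^sub>n word w2 - q' \<bullet>\<^sub>n word w2 \<in> ?L" if "s_word S p' w1" "s_word S q' w1" for p' q'
      using lower_span_mult_right[OF Node.IH(1)[OF that]] by (simp add: nmult_linear)
    have diffs': "word w1 \<bullet>\<^sub>n p' - word w1 \<bullet>\<^sub>n q' \<in> ?L" if "s_word S p' w2" "s_word S q' w2" for p' q'
      using lower_span_mult_left[OF Node.IH(2)[OF that]] by (simp add: nmult_linear)
    from Node.prems(1) show ?case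
    proof cases
      case base
      then show ?thesis using composition[of p q] Node.prems(2) by simp
    next
      case p: (right p')
      from Node.prems(2) show ?thesis
      proof cases
        case base
        then show ?thesis using composition[of q p] Node.prems(1) flip by simp
      next
        case (right q')
        then show ?thesis using p diffs by simp
      next
        case (left q')
        then show ?thesis using p disjoint by simp
      qed
    next
      case p: (left p')
      from Node.prems(2) show ?thesis
      proof cases
        case base
        then show ?thesis using composition[of q p] Node.prems(1) flip by simp
      next
        case (right q')
        then show ?thesis using p disjoint[of q' p'] flip by simp
      next
        case (left q')
        then show ?thesis using p diffs' by simp
      qed
    qed
  qed
qed

section \<open>The generated ideal as a span of S-words\<close>

text \<open>\<open>S\<close>-words are multiplied by words only; since words span the algebra,
  bilinearity gives all other factors.\<close>

lemma two_sided_ideal_span_s_words: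
  "two_sided_ideal (nalg.span {p. \<exists>w. s_word S p w})" (is "two_sided_ideal ?J")
proof -
  have word_left: "word v \<bullet>\<^sub>n p \<in> ?J" and word_right: "p \<bullet>\<^sub>n word v \<in> ?J"
    if "s_word S p w" for p v w
    using s_word.left[OF that, of v] s_word.right[OF that, of v] by (blast intro: nalg.span_base)+
  have left: "g \<bullet>\<^sub>n p \<in> ?J" and right: "p \<bullet>\<^sub>n g \<in> ?J" if "s_word S p w" for p g w
    using word_left[OF that] word_right[OF that]
    by (blast intro: nmult_span_left[OF in_span_words] nmult_span_right[OF in_span_words]
        nalg.subspace_span)+
  have "f \<bullet>\<^sub>n g \<in> ?J" "g \<bullet>\<^sub>n f \<in> ?J" if "f \<in> ?J" for f g
    using left right that
    by (blast intro: nmult_span_left[OF that] nmult_span_right[OF that] nalg.subspace_span)+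
  then show ?thesis
    by (simp add: two_sided_ideal_def nalg.span_zero nalg.span_add nalg.span_scale)
qed

lemma two_sided_ideal_subspace: "two_sided_ideal J \<Longrightarrow> nalg.subspace J"
  by (simp add: two_sided_ideal_def nalg.subspace_def)

lemma s_word_in_ideal: "s_word S p w \<Longrightarrow> two_sided_ideal J \<Longrightarrow> S \<subseteq> J \<Longrightarrow> p \<in> J"
  by (induction rule: s_word.induct) (auto simp: two_sided_ideal_def)

lemma ideal_hull_eq_span_s_words:
  "two_sided_ideal hull S = nalg.span {p. \<exists>w. s_word S p w}"
proof (rule hull_unique)
  show "S \<subseteq> nalg.span {p. \<exists>w. s_word S p w}"
    by (blast intro: nalg.span_base s_word.base)
  show "nalg.span {p. \<exists>w. s_word S p w} \<subseteq> J" if "S \<subseteq> J" "two_sided_ideal J" for J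
    using that s_word_in_ideal by (intro nalg.span_minimal two_sided_ideal_subspace) blast+
qed (rule two_sided_ideal_span_s_words)

section \<open>Reducible words and normal forms\<close>

definition reducible :: "('x::linorder, 'k::field) nalg set \<Rightarrow> 'x nword \<Rightarrow> bool" where
  "reducible S w \<longleftrightarrow> (\<exists>p. s_word S p w)"

text \<open>An \<open>S\<close>-word with leading word \<open>w\<close> marks an occurrence of some
  \<open>lead s\<close> in \<open>w\<close>; conversely, putting \<open>s\<close> in place of such
  an occurrence builds an \<open>S\<close>-word.\<close>

lemma reducible_iff_subword: "reducible S w \<longleftrightarrow> (\<exists>s\<in>S. lead s \<in> subwords w)"
proof
  have self: "w \<in> subwords w" for w :: "'a nword" by (cases w) auto
  show "\<exists>s\<in>S. lead s \<in> subwords w" if "reducible S w"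
  proof -
    from that obtain p where "s_word S p w" by (auto simp: reducible_def)
    then show ?thesis by induction (auto intro: self)
  qed
  show "reducible S w" if "\<exists>s\<in>S. lead s \<in> subwords w"
    using that
  proof (induction w)
    case (Letter x)
    then obtain s where "s \<in> S" "lead s = Letter x" by auto
    then show ?case using s_word.base[of s S] by (auto simp: reducible_def)
  next
    case (Node u v)
    then show ?case unfolding reducible_def
      by simp (metis s_word.base s_word.left s_word.right)
  qed
qed

lemma monic_if_groebner_shirshov: "groebner_shirshov_basis S \<Longrightarrow> \<forall>s\<in>S. monic s"
  by (simp add: groebner_shirshov_basis_def)

lemma reducible_lookup_nonzero:
  fixes S :: "('x::wellorder, 'k::field) nalg set"
  assumes S: "groebner_shirshov_basis S" and h: "h \<in> two_sided_ideal hull S" "h \<noteq> 0"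
  shows "\<exists>w. reducible S w \<and> Poly_Mapping.lookup h w \<noteq> 0"
proof -
  \<comment> \<open>One arbitrarily chosen \<open>S\<close>-word for each reducible word. By
    \<open>s_word_diff\<close> another choice differs only by \<open>S\<close>-words with smaller
    leading words, so well-founded induction shows that the chosen ones span the ideal.\<close>
  define N where "N w = (SOME p. s_word S p w)" for w
  have N: "s_word S (N w) w" if "reducible S w" for w
    using that someI_ex[of "\<lambda>p. s_word S p w"] by (simp add: N_def reducible_def)
  have lead_N: "lead (N w) = w" "monic (N w)" if "reducible S w" for w
    using lead_eqI[OF s_word_below[OF N[OF that] monic_if_groebner_shirshov[OF S]]] by simp_all
  let ?B = "N ` {w. reducible S w}"
  have "p \<in> nalg.span ?B" if "s_word S p w" for p w
    using that
  proof (induction w arbitrary: p rule: less_induct)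
    case (less w)
    have red: "reducible S w" using less.prems by (auto simp: reducible_def)
    have "lower_span S w \<subseteq> nalg.span ?B"
      unfolding lower_span_def using less.IH by (intro nalg.span_minimal) auto
    then have "p - N w \<in> nalg.span ?B"
      using s_word_diff[OF S less.prems N[OF red]] by blast
    moreover have "N w \<in> nalg.span ?B" using red by (intro nalg.span_base) simp
    ultimately have "(p - N w) + N w \<in> nalg.span ?B" by (rule nalg.span_add)
    then show ?case by simp
  qed
  then have "nalg.span {p. \<exists>w. s_word S p w} \<subseteq> nalg.span ?B"
    by (intro nalg.span_minimal) auto
  then have "h \<in> nalg.span ?B" using h(1) by (auto simp: ideal_hull_eq_span_s_words)
  moreover have "inj_on lead ?B" by (auto intro!: inj_onI simp: lead_N)
  ultimately show ?thesis
    using lead_in_span[of h ?B] h(2) lead_N by auto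
qed

text \<open>Division: if \<open>p\<close> is an \<open>S\<close>-word with leading word
  \<open>w\<close>, then \<open>w\<close> is \<open>p\<close> minus \<open>p - w\<close>, and
  \<open>p - w\<close> involves only smaller words. The well-order on words makes this
  terminate.\<close>

lemma normal_form_exists:
  fixes S :: "('x::wellorder, 'k::field) nalg set"
  assumes monic: "\<forall>s\<in>S. monic s"
  shows "\<exists>r \<in> nalg.span (word ` {w. \<not> reducible S w}). f - r \<in> two_sided_ideal hull S"
proof -
  let ?I = "word ` {w. \<not> reducible S w}" and ?P = "{p. \<exists>w. s_word S p w}"
  have words: "word w \<in> nalg.span (?I \<union> ?P)" for w
  proof (induction w rule: less_induct)
    case (less w)
    show ?case
    proof (cases "reducible S w")
      case True
      then obtain p where p: "s_word S p w" by (auto simp: reducible_def)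
      have "below w \<subseteq> nalg.span (?I \<union> ?P)"
        unfolding below_def using less.IH by (intro nalg.span_minimal) auto
      then have "p - word w \<in> nalg.span (?I \<union> ?P)" using s_word_below[OF p monic] by blast
      moreover have "p \<in> nalg.span (?I \<union> ?P)" using p by (intro nalg.span_base) blast
      ultimately show ?thesis using nalg.span_diff[of p _ "p - word w"] by fastforce
    qed (auto intro: nalg.span_base)
  qed
  have "nalg.span (range word) \<subseteq> nalg.span (?I \<union> ?P)"
    using words by (intro nalg.span_minimal) auto
  then have "f \<in> nalg.span (?I \<union> ?P)" using in_span_words by blast
  then obtain r j where rj: "r \<in> nalg.span ?I" "j \<in> nalg.span ?P" "f = r + j"
    unfolding nalg.span_Un by blast
  then have "f - r \<in> two_sided_ideal hull S" by (simp add: ideal_hull_eq_span_s_words)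
  then show ?thesis using rj(1) by blast
qed

section \<open>Bases of quotient algebras\<close>

text \<open>The hypotheses make the span of the words in \<open>U\<close> a linear complement of
  \<open>J\<close>. The proof carries this over to the carrier-based notion of basis in
  \<open>quot_alg J\<close>.\<close>

lemma quot_alg_word_basis:
  fixes J :: "('x, 'k::field) nalg set"
  assumes J: "two_sided_ideal J"
    and indep: "\<And>h. h \<in> nalg.span (word ` U) \<Longrightarrow> h \<in> J \<Longrightarrow> h = 0"
    and gen: "\<And>f. \<exists>r \<in> nalg.span (word ` U). f - r \<in> J"
  shows "inj_on (\<lambda>u. coset J (word u)) U"
    and "vectorspace.basis class_ring (quot_alg J) ((\<lambda>u. coset J (word u)) ` U)"
proof -
  let ?cl = "\<lambda>u. coset J (word u)"
  interpret Q: vectorspace "class_ring :: 'k ring" "quot_alg J"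
    by (rule vectorspace_quot_alg[OF J])
  note ops = quot_alg_ops[OF J]
  show inj: "inj_on ?cl U"
  proof (rule inj_onI)
    fix u v assume uv: "u \<in> U" "v \<in> U" "?cl u = ?cl v"
    have "word u - word v \<in> J" using uv(3) by (simp add: coset_eq_iff[OF J])
    moreover have "word u - word v \<in> nalg.span (word ` U)"
      using uv by (intro nalg.span_diff nalg.span_base imageI)
    ultimately have "word u = (word v :: ('x, 'k) nalg)" using indep by fastforce
    then show "u = v" by (metis lookup_word zero_neq_one)
  qed
  have carrier: "?cl ` F \<subseteq> carrier (quot_alg J)" for F by (auto simp: ops)
  \<comment> \<open>Coefficients of \<open>Q.lincomb\<close> are indexed by classes, not words.
    Injectivity on \<open>U\<close> keeps distinct words from merging, so a combination of classes
    is the class of the same combination of words.\<close>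
  have lincomb: "Q.lincomb a (?cl ` F) = coset J (\<Sum>u\<in>F. a (?cl u) *\<^sub>n word u)"
    if "finite F" "F \<subseteq> U" for a F
    using that
  proof (induction F)
    case empty
    then show ?case by (simp add: Q.lincomb_def ops)
  next
    case (insert u F)
    have "?cl u \<notin> ?cl ` F" using insert.hyps insert.prems inj by (auto dest: inj_onD)
    then have "Q.lincomb a (?cl ` F \<union> {?cl u}) =
        a (?cl u) \<odot>\<^bsub>quot_alg J\<^esub> ?cl u \<oplus>\<^bsub>quot_alg J\<^esub> Q.lincomb a (?cl ` F)"
      using insert.hyps carrier by (intro Q.lincomb_insert) (auto simp: ops)
    then show ?case using insert by (simp add: ops)
  qed
  show "Q.basis (?cl ` U)" unfolding Q.basis_def
  proof (intro conjI)
    show "\<not> Q.lin_dep (?cl ` U)"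
    proof
      assume "Q.lin_dep (?cl ` U)"
      then obtain A a v where A: "finite A" "A \<subseteq> ?cl ` U" "Q.lincomb a A = \<zero>\<^bsub>quot_alg J\<^esub>"
        "v \<in> A" "a v \<noteq> 0"
        unfolding Q.lin_dep_def by auto
      obtain F where F: "F \<subseteq> U" "finite F" "A = ?cl ` F"
        using A(1,2) finite_subset_image by metis
      let ?h = "\<Sum>u\<in>F. a (?cl u) *\<^sub>n word u"
      have "?h \<in> J" using A(3) F by (simp add: lincomb ops coset_eq_iff[OF J])
      moreover have "?h \<in> nalg.span (word ` U)"
        using F by (intro nalg.span_sum nalg.span_scale nalg.span_base) auto
      ultimately have h: "?h = 0" by (rule indep[rotated])
      obtain u where u: "u \<in> F" "v = ?cl u" using A(4) F(3) by blast
      have "Poly_Mapping.lookup ?h u = a v"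
        using u F(2) by (simp add: lookup_sum_pm lookup_word if_distrib cong: if_cong)
      then show False using h A(5) by simp
    qed
    show "Q.gen_set (?cl ` U)"
    proof
      show "Q.span (?cl ` U) \<subseteq> carrier (quot_alg J)" by (rule Q.span_is_subset2[OF carrier])
      show "carrier (quot_alg J) \<subseteq> Q.span (?cl ` U)"
      proof
        fix P assume "P \<in> carrier (quot_alg J)"
        then obtain f where f: "P = coset J f" by (auto simp: ops)
        obtain r where r: "r \<in> nalg.span (word ` U)" "f - r \<in> J" using gen by blast
        let ?F = "Poly_Mapping.keys r"
        have F: "?F \<subseteq> U" using span_words_lookup[OF r(1)] by (auto simp: in_keys_iff)
        \<comment> \<open>Each class in the image comes from exactly one word of \<open>U\<close>,
          so \<open>inv_into\<close> recovers the word whose coefficient in \<open>r\<close> is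
          wanted.\<close>
        let ?a = "\<lambda>P. Poly_Mapping.lookup r (inv_into U ?cl P)"
        have "Q.lincomb ?a (?cl ` ?F) = coset J (\<Sum>u\<in>?F. ?a (?cl u) *\<^sub>n word u)"
          using F by (intro lincomb) simp_all
        also have "(\<Sum>u\<in>?F. ?a (?cl u) *\<^sub>n word u) = (\<Sum>u\<in>?F. Poly_Mapping.lookup r u *\<^sub>n word u)"
          using F by (intro sum.cong) (auto simp: inv_into_f_f[OF inj])
        also have "\<dots> = r" by (rule nalg_expansion[symmetric])
        also have "coset J r = P" using r(2) f by (simp add: coset_eq_iff[OF J, symmetric])
        finally have "P = Q.lincomb ?a (?cl ` ?F)" ..
        then show "P \<in> Q.span (?cl ` U)"
          unfolding Q.span_def using F by (auto intro!: exI[of _ ?a] exI[of _ "?cl ` ?F"])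
      qed
    qed
  qed (rule carrier)
qed

subsection \<open>The defining relations of the enveloping algebra\<close>

lemma gen_mult: "gen i \<bullet>\<^sub>n gen j = word (Node (Letter i) (Letter j))"
  by (simp add: gen_def word_mult)

lemma linear_elt_below: "linear_elt a \<in> below (Node u v)"
proof -
  have "nalg.span (range gen) \<subseteq> below (Node u v)"
    by (intro nalg.span_minimal subspace_below)
      (auto simp: gen_def less_nword_def intro!: word_in_below)
  then show ?thesis using linear_elt_in_span by blast
qed

lemma linear_elt_mult_gen_below:
  assumes "2 < nlength w"
  shows "linear_elt a \<bullet>\<^sub>n gen l \<in> below w"
proof (rule nmult_span_left[OF linear_elt_in_span subspace_below])
  show "g \<bullet>\<^sub>n gen l \<in> below w" if "g \<in> range gen" for g
    using assms that by (auto simp: gen_mult intro!: word_in_below nlength_mono)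
qed

lemmas below_intros =
  nalg.subspace_diff[OF subspace_below] nalg.subspace_add[OF subspace_below]
  nalg.subspace_neg[OF subspace_below]

lemma rel_f_below:
  assumes "i > j"
  shows "rel_f \<alpha> i j - word (Node (Letter i) (Letter j)) \<in> below (Node (Letter i) (Letter j))"
proof -
  have "word (Node (Letter j) (Letter i)) \<in> below (Node (Letter i) (Letter j))"
    using assms by (intro word_in_below) (simp add: less_nword_def)
  then have "- word (Node (Letter j) (Letter i)) - linear_elt (\<alpha> i j)
      \<in> below (Node (Letter i) (Letter j))"
    by (intro below_intros linear_elt_below)
  then show ?thesis by (simp add: rel_f_def gen_mult)
qed

lemma rel_g_below:
  "rel_g \<beta> i j l - word (Node (Node (Letter i) (Letter j)) (Letter l))
    \<in> below (Node (Node (Letter i) (Letter j)) (Letter l))" (is "_ \<in> below ?w")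
proof -
  have "word (Node (Letter i) (Node (Letter j) (Letter l))) \<in> below ?w"
    by (intro word_in_below) (simp add: less_nword_def)
  then have "- word (Node (Letter i) (Node (Letter j) (Letter l))) - linear_elt (\<beta> i j l) \<in> below ?w"
    by (intro below_intros linear_elt_below)
  then show ?thesis by (simp add: rel_g_def gen_mult gen_def word_mult)
qed

lemma rel_h_below:
  assumes "i > j"
  shows "rel_h \<alpha> \<beta> i j l - word (Node (Letter i) (Node (Letter j) (Letter l)))
    \<in> below (Node (Letter i) (Node (Letter j) (Letter l)))" (is "_ \<in> below ?w")
proof -
  have "word (Node (Letter j) (Node (Letter i) (Letter l))) \<in> below ?w"
    using assms by (intro word_in_below) (simp add: less_nword_def)
  moreover have "linear_elt (\<alpha> i j) \<bullet>\<^sub>n gen l \<in> below ?w"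
    by (rule linear_elt_mult_gen_below) simp
  ultimately have "- word (Node (Letter j) (Node (Letter i) (Letter l)))
      - linear_elt (\<alpha> i j) \<bullet>\<^sub>n gen l - linear_elt (\<beta> j i l) + linear_elt (\<beta> i j l) \<in> below ?w"
    by (intro below_intros linear_elt_below)
  then show ?thesis by (simp add: rel_h_def gen_def word_mult)
qed

lemmas lead_rel [simp] =
  lead_eqI(1)[OF rel_f_below] lead_eqI(1)[OF rel_g_below] lead_eqI(1)[OF rel_h_below]

lemma gs_set_cases:
  assumes "s \<in> gs_set \<alpha> \<beta>"
  obtains (f) i j where "s = rel_f \<alpha> i j" "i > j"
  | (g) i j l where "s = rel_g \<beta> i j l"
  | (h) i j l where "s = rel_h \<alpha> \<beta> i j l" "i > j" "l \<ge> j"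
  using assms by (auto simp: gs_set_def)

lemma gs_set_monic: "s \<in> gs_set \<alpha> \<beta> \<Longrightarrow> monic s"
  by (erule gs_set_cases)
    (auto intro: lead_eqI(3)[OF rel_f_below] lead_eqI(3)[OF rel_g_below] lead_eqI(3)[OF rel_h_below])

lemma gs_set_leads:
  "lead ` gs_set \<alpha> \<beta> =
     {Node (Letter i) (Letter j) | i j. i > j} \<union>
     {Node (Node (Letter i) (Letter j)) (Letter l) | i j l. True} \<union>
     {Node (Letter i) (Node (Letter j) (Letter l)) | i j l. i > j \<and> l \<ge> j}"
  (is "_ = ?R")
proof
  show "lead ` gs_set \<alpha> \<beta> \<subseteq> ?R" by (auto elim!: gs_set_cases)
  show "?R \<subseteq> lead ` gs_set \<alpha> \<beta>"
  proof
    fix w assume "w \<in> ?R"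
    then consider i j where "w = lead (rel_f \<alpha> i j)" "i > j"
      | i j l where "w = lead (rel_g \<beta> i j l)"
      | i j l where "w = lead (rel_h \<alpha> \<beta> i j l)" "i > j" "l \<ge> j"
      by auto
    then show "w \<in> lead ` gs_set \<alpha> \<beta>" unfolding gs_set_def by cases blast+
  qed
qed

lemma irr_words_eq: "irr_words = {w. \<not> reducible (gs_set \<alpha> \<beta>) w}"
proof -
  have "reducible (gs_set \<alpha> \<beta>) w \<longleftrightarrow> (\<exists>v\<in>lead ` gs_set \<alpha> \<beta>. v \<in> subwords w)" for w
    by (simp add: reducible_iff_subword)
  then have "reducible (gs_set \<alpha> \<beta>) w \<longleftrightarrow> w \<notin> irr_words" for w
    unfolding gs_set_leads irr_words_def by auto
  then show ?thesis by auto
qed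

text \<open>The three families of leading words have different shapes and display their indices, so
  a leading word determines its relation.\<close>

lemma gs_set_lead_inj:
  assumes "s \<in> gs_set \<alpha> \<beta>"
  shows "lead s \<noteq> Letter i"
    and "lead s = Node (Letter i) (Letter j) \<Longrightarrow> s = rel_f \<alpha> i j \<and> i > j"
    and "lead s = Node (Node (Letter i) (Letter j)) (Letter l) \<Longrightarrow> s = rel_g \<beta> i j l"
    and "lead s = Node (Letter i) (Node (Letter j) (Letter l)) \<Longrightarrow> s = rel_h \<alpha> \<beta> i j l"
  using assms by (auto elim!: gs_set_cases)

lemma gs_set_s_word_Letter:
  assumes "s \<in> gs_set \<alpha> \<beta>"
  shows "\<not> s_word {s} p (Letter i)"
proof
  assume "s_word {s} p (Letter i)"
  then show False by cases (use gs_set_lead_inj(1)[OF assms, of i] in simp)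
qed

lemma gs_set_s_word_Node:
  assumes s: "s \<in> gs_set \<alpha> \<beta>" and p: "s_word {s} p (Node (Letter i) (Letter j))"
  shows "p = rel_f \<alpha> i j \<and> i > j"
  using p
proof cases
  case base
  then show ?thesis using gs_set_lead_inj(2)[OF s, of i j] by simp
qed (use gs_set_s_word_Letter[OF s] in blast)+

text \<open>A proper subword that is itself a leading word must have length two. The leading word of
  \<open>rel_f\<close> has none, that of \<open>rel_g\<close> contains
  \<open>e\<^sub>ie\<^sub>j\<close>, reducible for \<open>i > j\<close>, and that of
  \<open>rel_h\<close> contains \<open>e\<^sub>je\<^sub>l\<close>, irreducible because
  \<open>l \<ge> j\<close>. A relation composed with itself at the full word gives
  \<open>0\<close>.\<close>

lemma gs_set_compositions:
  assumes f: "f \<in> gs_set \<alpha> \<beta>" and s: "s \<in> gs_set \<alpha> \<beta>" and h: "h \<in> compositions f s"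
  shows "h = 0 \<or> (\<exists>i j l. i > j \<and> f = rel_g \<beta> i j l \<and> h = rel_g \<beta> i j l - rel_f \<alpha> i j \<bullet>\<^sub>n gen l)"
proof -
  from h obtain p where p: "h = f - p" "s_word {s} p (lead f)" by (auto simp: compositions_def)
  from f show ?thesis
  proof (cases rule: gs_set_cases)
    case (f i j)
    then show ?thesis using p gs_set_s_word_Node[OF s] by simp
  next
    case (g i j l)
    then have "s_word {s} p (Node (Node (Letter i) (Letter j)) (Letter l))" using p(2) by simp
    then show ?thesis
    proof cases
      case base
      then show ?thesis using gs_set_lead_inj(3)[OF s, of i j l] g p(1) by simp
    next
      case (right q)
      then have "h = rel_g \<beta> i j l - rel_f \<alpha> i j \<bullet>\<^sub>n gen l" "i > j"
        using gs_set_s_word_Node[OF s] g p(1) by (auto simp: gen_def)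
      then show ?thesis using g by blast
    next
      case (left q)
      then show ?thesis using gs_set_s_word_Letter[OF s] by blast
    qed
  next
    case (h i j l)
    then have "s_word {s} p (Node (Letter i) (Node (Letter j) (Letter l)))" using p(2) by simp
    then show ?thesis
    proof cases
      case base
      then show ?thesis using gs_set_lead_inj(4)[OF s, of i j l] h p(1) by simp
    next
      case (right q)
      then show ?thesis using gs_set_s_word_Letter[OF s] by blast
    next
      case (left q)
      then show ?thesis using gs_set_s_word_Node[OF s] h(3) by (meson leD)
    qed
  qed
qed

text \<open>This explains the shape of \<open>rel_h\<close>: it is what the composition of
  \<open>rel_f\<close> in \<open>rel_g\<close> forces, up to \<open>rel_g\<close> with
  \<open>i\<close> and \<open>j\<close> exchanged. The same identity puts \<open>rel_h\<close> into
  the ideal.\<close>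

lemma rel_g_minus_rel_f:
  "rel_g \<beta> i j l - rel_f \<alpha> i j \<bullet>\<^sub>n gen l = rel_g \<beta> j i l - rel_h \<alpha> \<beta> i j l"
  by (simp only: rel_f_def rel_g_def rel_h_def nmult_linear) (simp add: algebra_simps)

subsection \<open>Akivis algebras with a basis\<close>

locale akivis_algebra_basis = akivis_algebra scale bracket triple
  for scale :: "'k::field \<Rightarrow> 'a::ab_group_add \<Rightarrow> 'a"
    and bracket :: "'a \<Rightarrow> 'a \<Rightarrow> 'a"
    and triple :: "'a \<Rightarrow> 'a \<Rightarrow> 'a \<Rightarrow> 'a" +
  fixes e :: "'i::wellorder \<Rightarrow> 'a"
    and \<alpha> :: "'i \<Rightarrow> 'i \<Rightarrow> 'i \<Rightarrow>\<^sub>0 'k"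
    and \<beta> :: "'i \<Rightarrow> 'i \<Rightarrow> 'i \<Rightarrow> 'i \<Rightarrow>\<^sub>0 'k"
  assumes is_basis: "is_basis scale e"
    and bracket_basis: "bracket (e i) (e j) =
      (\<Sum>m\<in>Poly_Mapping.keys (\<alpha> i j). scale (Poly_Mapping.lookup (\<alpha> i j) m) (e m))"
    and triple_basis: "triple (e i) (e j) (e l) =
      (\<Sum>n\<in>Poly_Mapping.keys (\<beta> i j l). scale (Poly_Mapping.lookup (\<beta> i j l) n) (e n))"
begin

lemma inj_e: "inj e" and independent_e: "independent (range e)" and span_e: "span (range e) = UNIV"
  using is_basis by (simp_all add: is_basis_def)

text \<open>Unlike \<open>linear_elt\<close>, which acts on given coordinate vectors, this map
  applies directly to nested brackets.\<close>

definition embed :: "'a \<Rightarrow> ('i, 'k) nalg" where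
  "embed = vector_space_pair.construct scale nsmult (range e) (\<lambda>b. gen (inv_into UNIV e b))"

lemma linear_embed: "Vector_Spaces.linear scale nsmult embed"
proof -
  interpret vector_space_pair scale "nsmult :: 'k \<Rightarrow> ('i, 'k) nalg \<Rightarrow> ('i, 'k) nalg" ..
  show ?thesis unfolding embed_def by (rule linear_construct[OF independent_e])
qed

lemma embed_basis: "embed (e i) = gen i"
proof -
  interpret vector_space_pair scale "nsmult :: 'k \<Rightarrow> ('i, 'k) nalg \<Rightarrow> ('i, 'k) nalg" ..
  show ?thesis unfolding embed_def by (simp add: construct_basis[OF independent_e] inj_e)
qed

sublocale embed: Vector_Spaces.linear scale nsmult embed
  by (rule linear_embed)

lemma embed_bracket_basis: "embed (bracket (e i) (e j)) = linear_elt (\<alpha> i j)"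
  by (simp add: bracket_basis linear_elt_def embed.sum embed.scale embed_basis)

lemma embed_triple_basis: "embed (triple (e i) (e j) (e l)) = linear_elt (\<beta> i j l)"
  by (simp add: triple_basis linear_elt_def embed.sum embed.scale embed_basis)

lemma bracket_skew: "bracket y x = - bracket x y"
proof -
  interpret r: Vector_Spaces.linear scale scale "\<lambda>y. bracket z y" for z
    by (rule bracket_linear_right)
  interpret l: Vector_Spaces.linear scale scale "\<lambda>x. bracket x z" for z
    by (rule bracket_linear_left)
  have "bracket x y + bracket y x = 0"
    using bracket_self[of "x + y"] bracket_self[of x] bracket_self[of y]
    by (simp add: r.add l.add add.commute)
  then show ?thesis by (simp add: eq_neg_iff_add_eq_0 add.commute)
qed

lemma linear_elt_skew: "linear_elt (\<alpha> j i) = - linear_elt (\<alpha> i j)"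
  by (simp flip: embed_bracket_basis add: bracket_skew[of "e j" "e i"] embed.neg)

lemma rel_f_skew: "rel_f \<alpha> j i = - rel_f \<alpha> i j"
  by (simp add: rel_f_def linear_elt_skew[of j i])

lemma rel_f_refl: "rel_f \<alpha> i i = 0"
  by (simp add: rel_f_def bracket_self flip: embed_bracket_basis)

text \<open>\<open>rel_f\<close> is skew in its indices, so the pairs with \<open>i > j\<close>
  yield all the others.\<close>

lemma rel_f_in_subspace:
  assumes "nalg.subspace T" "\<And>i j. i > j \<Longrightarrow> rel_f \<alpha> i j \<in> T"
  shows "rel_f \<alpha> i j \<in> T"
proof (cases i j rule: linorder_cases)
  case less
  then show ?thesis using assms nalg.subspace_neg[OF assms(1), of "rel_f \<alpha> j i"]
    by (simp flip: rel_f_skew)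
qed (use assms nalg.subspace_0 in \<open>auto simp: rel_f_refl\<close>)

text \<open>The expression is bilinear in \<open>x\<close> and \<open>y\<close> and equals
  \<open>rel_f\<close> on basis vectors. It will be applied with a bracket as one argument, which
  avoids expanding that bracket in coordinates.\<close>

lemma commutator_in_subspace:
  assumes T: "nalg.subspace T" and rel_f: "\<And>i j. i > j \<Longrightarrow> rel_f \<alpha> i j \<in> T"
  shows "embed x \<bullet>\<^sub>n embed y - embed y \<bullet>\<^sub>n embed x - embed (bracket x y) \<in> T" (is "?c x y \<in> T")
proof -
  interpret r: Vector_Spaces.linear scale scale "\<lambda>y. bracket z y" for z
    by (rule bracket_linear_right)
  interpret l: Vector_Spaces.linear scale scale "\<lambda>x. bracket x z" for z
    by (rule bracket_linear_left)
  have c_add: "?c (x + x') y = ?c x y + ?c x' y" "?c x (y + y') = ?c x y + ?c x y'" for x x' y y'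
    by (simp_all add: embed.add l.add r.add nmult_linear)
  have c_scale: "?c (scale a x) y = a *\<^sub>n ?c x y" "?c x (scale a y) = a *\<^sub>n ?c x y" for a x y
    by (simp_all add: embed.scale l.scale r.scale nmult_linear nsmult_simps)
  have c_zero: "?c 0 y = 0" "?c x 0 = 0" for x y
    using c_scale(1)[of 0 0 y] c_scale(2)[of x 0 0] by simp_all
  have "?c (e i) (e j) \<in> T" for i j
    using rel_f_in_subspace[OF T rel_f, of i j] by (simp add: rel_f_def embed_basis embed_bracket_basis)
  moreover have "subspace {x. ?c x y \<in> T}" "subspace {y. ?c x y \<in> T}" for x y
    using T unfolding subspace_def nalg.subspace_def mem_Collect_eq c_add c_scale c_zero by blast+
  ultimately have "span (range e) \<subseteq> {y. ?c (e i) y \<in> T}" for i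
    by (intro span_minimal) auto
  then have "?c (e i) y \<in> T" for i y using span_e by blast
  then have "span (range e) \<subseteq> {x. ?c x y \<in> T}" for y
    using \<open>\<And>y x. subspace {x. ?c x y \<in> T}\<close> by (intro span_minimal) auto
  then show ?thesis using span_e by blast
qed

section \<open>Triviality of the compositions\<close>

lemma gs_composition_trivial:
  assumes ij: "i > j"
  shows "rel_g \<beta> i j l - rel_f \<alpha> i j \<bullet>\<^sub>n gen l
    \<in> lower_span (gs_set \<alpha> \<beta>) (Node (Node (Letter i) (Letter j)) (Letter l))"
    (is "_ \<in> ?T")
proof -
  note intros = nalg.subspace_diff[OF subspace_lower_span] nalg.subspace_add[OF subspace_lower_span]
    nalg.subspace_neg[OF subspace_lower_span]
  \<comment> \<open>Why all terms below are small enough: \<open>rel_f\<close> has leading words of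
    length two, the products \<open>gf\<close> and the relations \<open>rel_h\<close> have a single
    letter as left factor of theirs, and \<open>rel_g \<beta> j i l\<close> is smaller because
    \<open>j < i\<close>.\<close>
  have lower: "s \<in> ?T" if "s \<in> gs_set \<alpha> \<beta>"
    "lead s < Node (Node (Letter i) (Letter j)) (Letter l)" for s
    using lower_span_base[OF s_word.base] that by blast
  have f: "rel_f \<alpha> a b \<in> ?T" if "a > b" for a b
    using that by (intro lower) (auto simp: gs_set_def less_nword_def)
  have gf: "gen a \<bullet>\<^sub>n rel_f \<alpha> b c \<in> ?T" if "b > c" for a b c
  proof -
    have "s_word (gs_set \<alpha> \<beta>) (word (Letter a) \<bullet>\<^sub>n rel_f \<alpha> b c) (Node (Letter a) (lead (rel_f \<alpha> b c)))"
      using that by (intro s_word.left s_word.base) (auto simp: gs_set_def)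
    then show ?thesis using that
      by (auto simp: less_nword_def gen_def intro: lower_span_base)
  qed
  have h: "rel_h \<alpha> \<beta> a b c \<in> ?T" if "a > b" "c \<ge> b" for a b c
    using that by (intro lower) (auto simp: gs_set_def less_nword_def)
  have g: "rel_g \<beta> j i l \<in> ?T"
    using ij by (intro lower) (auto simp: gs_set_def less_nword_def)
  show ?thesis
  proof (cases "l \<ge> j")
    case True
    then show ?thesis
      using ij g h by (simp add: rel_g_minus_rel_f[of \<beta> i j l \<alpha>] intros)
  next
    \<comment> \<open>Now \<open>rel_h \<alpha> \<beta> i j l\<close> is not among the relations of
      \<open>S\<close>; its leading word is reducible through
      \<open>e\<^sub>je\<^sub>l\<close>.\<close>
    case False
    then have lj: "j > l" and li: "i > l" using ij by auto
    \<comment> \<open>With a bracket as first argument, \<open>comm\<close> exchanges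
      \<open>{e\<^sub>ie\<^sub>j}e\<^sub>l\<close> for \<open>e\<^sub>l{e\<^sub>ie\<^sub>j}\<close>
      plus a double bracket, to which the Akivis identity applies.\<close>
    define comm where "comm x y = embed x \<bullet>\<^sub>n embed y - embed y \<bullet>\<^sub>n embed x - embed (bracket x y)" for x y
    have comm: "comm x y \<in> ?T" for x y
      unfolding comm_def by (rule commutator_in_subspace[OF subspace_lower_span f])
    have comm_basis: "comm (bracket (e a) (e b)) (e c) =
        linear_elt (\<alpha> a b) \<bullet>\<^sub>n gen c - gen c \<bullet>\<^sub>n linear_elt (\<alpha> a b)
        - embed (bracket (bracket (e a) (e b)) (e c))" for a b c
      by (simp add: comm_def embed_bracket_basis embed_basis)
    let ?x = "e i" and ?y = "e j" and ?z = "e l"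
    \<comment> \<open>The Akivis identity has \<open>[[z,x],y]\<close>, but for \<open>i > l\<close>
      the relations used bring in \<open>{e\<^sub>ie\<^sub>l}\<close>, so the sign is moved
      first.\<close>
    have "bracket (bracket ?z ?x) ?y = - bracket (bracket ?x ?z) ?y"
    proof -
      interpret Vector_Spaces.linear scale scale "\<lambda>x. bracket x ?y"
        by (rule bracket_linear_left)
      show ?thesis by (simp add: bracket_skew[of ?z ?x] neg)
    qed
    then have "bracket (bracket ?x ?y) ?z + bracket (bracket ?y ?z) ?x - bracket (bracket ?x ?z) ?y =
        triple ?x ?y ?z + triple ?z ?x ?y + triple ?y ?z ?x
        - triple ?x ?z ?y - triple ?y ?x ?z - triple ?z ?y ?x"
      using akivis_identity[of ?x ?y ?z] by simp
    from arg_cong[OF this, of embed]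
    have akivis: "embed (bracket (bracket ?x ?y) ?z) =
        linear_elt (\<beta> i j l) + linear_elt (\<beta> l i j) + linear_elt (\<beta> j l i)
        - linear_elt (\<beta> i l j) - linear_elt (\<beta> j i l) - linear_elt (\<beta> l j i)
        - embed (bracket (bracket ?y ?z) ?x) + embed (bracket (bracket ?x ?z) ?y)"
      by (simp add: embed.add embed.diff embed_triple_basis algebra_simps)
    \<comment> \<open>Since \<open>l < j\<close>, the words \<open>e\<^sub>i(e\<^sub>je\<^sub>l)\<close> and \<open>e\<^sub>j(e\<^sub>ie\<^sub>l)\<close> of the composition are first rewritten to
      \<open>e\<^sub>i(e\<^sub>le\<^sub>j)\<close> and \<open>e\<^sub>j(e\<^sub>le\<^sub>i)\<close>, and these by \<open>h\<close> to \<open>e\<^sub>l(e\<^sub>ie\<^sub>j)\<close> and \<open>e\<^sub>l(e\<^sub>je\<^sub>i)\<close>.\<close>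
    have "rel_g \<beta> i j l - rel_f \<alpha> i j \<bullet>\<^sub>n gen l =
        rel_g \<beta> j i l + gen j \<bullet>\<^sub>n rel_f \<alpha> i l + rel_h \<alpha> \<beta> j l i
        - gen i \<bullet>\<^sub>n rel_f \<alpha> j l - rel_h \<alpha> \<beta> i l j - gen l \<bullet>\<^sub>n rel_f \<alpha> i j
        + comm (bracket ?x ?y) ?z + comm (bracket ?y ?z) ?x - comm (bracket ?x ?z) ?y"
      by (simp only: rel_f_def rel_g_def rel_h_def nmult_linear comm_basis akivis)
        (simp add: algebra_simps)
    also have "\<dots> \<in> ?T"
      using ij lj li by (intro intros g gf h comm) auto
    finally show ?thesis .
  qed
qed

lemma groebner_shirshov_basis_gs_set: "groebner_shirshov_basis (gs_set \<alpha> \<beta>)"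
  unfolding groebner_shirshov_basis_def
proof (intro conjI ballI)
  show "gs_set \<alpha> \<beta> \<noteq> {}" by (auto simp: gs_set_def)
  show "monic s" if "s \<in> gs_set \<alpha> \<beta>" for s using that by (rule gs_set_monic)
  show "trivial_mod (gs_set \<alpha> \<beta>) (lead f) h"
    if "f \<in> gs_set \<alpha> \<beta>" "g \<in> gs_set \<alpha> \<beta>" "h \<in> compositions f g" for f g h
    using gs_set_compositions[OF that] gs_composition_trivial
    by (auto simp: trivial_mod_iff nalg.subspace_0[OF subspace_lower_span])
qed

text \<open>Skew-symmetry provides \<open>rel_f\<close> for the pairs outside \<open>i > j\<close>,
  and \<open>rel_g_minus_rel_f\<close> expresses \<open>rel_h\<close> through \<open>rel_f\<close>
  and \<open>rel_g\<close>.\<close>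

lemma env_ideal_eq: "env_ideal \<alpha> \<beta> = two_sided_ideal hull gs_set \<alpha> \<beta>"
proof
  let ?R = "{rel_f \<alpha> i j | i j. True} \<union> {rel_g \<beta> i j l | i j l. True}"
  have ideal: "two_sided_ideal (two_sided_ideal hull S)" for S :: "('i, 'k) nalg set"
    by (rule two_sided_ideal_hull)
  note subspace = two_sided_ideal_subspace[OF ideal]
  have "rel_f \<alpha> i j \<in> two_sided_ideal hull gs_set \<alpha> \<beta>" for i j
    by (rule rel_f_in_subspace[OF subspace], rule hull_inc) (auto simp: gs_set_def)
  moreover have "rel_g \<beta> i j l \<in> two_sided_ideal hull gs_set \<alpha> \<beta>" for i j l
    by (rule hull_inc) (unfold gs_set_def, blast)
  ultimately show "env_ideal \<alpha> \<beta> \<subseteq> two_sided_ideal hull gs_set \<alpha> \<beta>"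
    unfolding env_ideal_def by (intro hull_minimal ideal) auto
  have f: "rel_f \<alpha> i j \<in> env_ideal \<alpha> \<beta>" and g: "rel_g \<beta> i j l \<in> env_ideal \<alpha> \<beta>" for i j l
    unfolding env_ideal_def by (rule hull_inc, blast)+
  have h: "rel_h \<alpha> \<beta> i j l \<in> env_ideal \<alpha> \<beta>" for i j l
  proof -
    have "rel_h \<alpha> \<beta> i j l = rel_g \<beta> j i l - (rel_g \<beta> i j l - rel_f \<alpha> i j \<bullet>\<^sub>n gen l)"
      by (simp add: rel_g_minus_rel_f[of \<beta> i j l \<alpha>])
    moreover have "rel_f \<alpha> i j \<bullet>\<^sub>n gen l \<in> env_ideal \<alpha> \<beta>"
      using f ideal unfolding env_ideal_def two_sided_ideal_def by blast
    ultimately show ?thesis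
      using g nalg.subspace_diff[OF subspace] unfolding env_ideal_def by simp
  qed
  have "gs_set \<alpha> \<beta> \<subseteq> env_ideal \<alpha> \<beta>" using f g h by (auto simp: gs_set_def)
  then show "two_sided_ideal hull gs_set \<alpha> \<beta> \<subseteq> env_ideal \<alpha> \<beta>"
    unfolding env_ideal_def by (rule hull_minimal) (rule ideal)
qed

lemma env_ideal: "two_sided_ideal (env_ideal \<alpha> \<beta>)"
  unfolding env_ideal_def by (rule two_sided_ideal_hull)

lemma irr_span_env_ideal:
  assumes "h \<in> nalg.span (word ` irr_words)" "h \<in> env_ideal \<alpha> \<beta>"
  shows "h = 0"
proof (rule ccontr)
  assume "h \<noteq> 0"
  then obtain w where "reducible (gs_set \<alpha> \<beta>) w" "Poly_Mapping.lookup h w \<noteq> 0"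
    using reducible_lookup_nonzero[OF groebner_shirshov_basis_gs_set] assms(2)
    unfolding env_ideal_eq by blast
  then show False
    using span_words_lookup[OF assms(1), of w] by (simp add: irr_words_eq[of \<alpha> \<beta>])
qed

lemma irr_words_basis:
  "inj_on (\<lambda>u. env_class \<alpha> \<beta> (word u)) irr_words"
  "vectorspace.basis class_ring (env_alg \<alpha> \<beta>) ((\<lambda>u. env_class \<alpha> \<beta> (word u)) ` irr_words)"
proof -
  have "\<exists>r\<in>nalg.span (word ` irr_words). f - r \<in> env_ideal \<alpha> \<beta>" for f
    unfolding irr_words_eq[of \<alpha> \<beta>] env_ideal_eq
    by (rule normal_form_exists) (blast intro: gs_set_monic)
  from quot_alg_word_basis[OF env_ideal irr_span_env_ideal this]
  show "inj_on (\<lambda>u. env_class \<alpha> \<beta> (word u)) irr_words"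
    "vectorspace.basis class_ring (env_alg \<alpha> \<beta>) ((\<lambda>u. env_class \<alpha> \<beta> (word u)) ` irr_words)"
    by (simp_all add: env_class_def env_alg_def)
qed

section \<open>Injectivity of the embedding\<close>

lemma embed_eq_0:
  assumes "embed x = 0"
  shows "x = 0"
proof -
  have "x \<in> span (range e)" using span_e by simp
  then obtain t r where t: "finite t" "t \<subseteq> range e" "x = (\<Sum>b\<in>t. scale (r b) b)"
    unfolding span_explicit by blast
  have "r b = 0" if "b \<in> t" for b
  proof -
    from that t(2) obtain i where i: "b = e i" by blast
    have "embed x = (\<Sum>b\<in>t. r b *\<^sub>n word (Letter (inv_into UNIV e b)))"
      unfolding t(3) embed.sum
    proof (rule sum.cong)
      show "embed (scale (r b) b) = r b *\<^sub>n word (Letter (inv_into UNIV e b))" if "b \<in> t" for b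
        using that t(2) by (auto simp: embed.scale embed_basis inj_e gen_def)
    qed simp
    \<comment> \<open>The coefficient at \<open>Letter i\<close> recovers the coordinate of
      \<open>x\<close> at \<open>e i\<close>.\<close>
    then have "0 = (\<Sum>b\<in>t. r b * Poly_Mapping.lookup (word (Letter (inv_into UNIV e b))) (Letter i))"
      using assms by (simp flip: lookup_nsmult lookup_sum_pm)
    also have "\<dots> = (\<Sum>b\<in>t. if b = e i then r b else 0)"
    proof (rule sum.cong)
      show "r b * Poly_Mapping.lookup (word (Letter (inv_into UNIV e b))) (Letter i) = (if b = e i then r b else 0)"
        if "b \<in> t" for b
        using that t(2) by (auto simp: lookup_word inj_e)
    qed simp
    also have "\<dots> = r b" using t(1) that i by simp
    finally show ?thesis by simp
  qed
  then show ?thesis using t(3) by simp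
qed

text \<open>All forbidden words have at least two letters, so letters are irreducible.\<close>

lemma embed_in_irr_span: "embed x \<in> nalg.span (word ` irr_words)"
proof -
  have "embed ` span (range e) = nalg.span (embed ` range e)"
    by (rule embed.span_image[symmetric])
  moreover have "embed ` range e \<subseteq> word ` irr_words"
    by (auto simp: embed_basis gen_def irr_words_def)
  ultimately show ?thesis using span_e nalg.span_mono by blast
qed

lemma env_class_embed_inj: "inj (\<lambda>x. env_class \<alpha> \<beta> (embed x))"
proof (rule injI)
  fix x y assume "env_class \<alpha> \<beta> (embed x) = env_class \<alpha> \<beta> (embed y)"
  then have "embed (x - y) \<in> env_ideal \<alpha> \<beta>"
    by (simp add: env_class_def coset_eq_iff[OF env_ideal] embed.diff)
  then have "x - y = 0" using irr_span_env_ideal embed_in_irr_span embed_eq_0 by blast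
  then show "x = y" by simp
qed

lemma env_class_embed_linear:
  "env_class \<alpha> \<beta> (embed x) \<in> carrier (env_alg \<alpha> \<beta>)"
  "env_class \<alpha> \<beta> (embed (x + y)) =
     env_class \<alpha> \<beta> (embed x) \<oplus>\<^bsub>env_alg \<alpha> \<beta>\<^esub> env_class \<alpha> \<beta> (embed y)"
  "env_class \<alpha> \<beta> (embed (scale c x)) = c \<odot>\<^bsub>env_alg \<alpha> \<beta>\<^esub> env_class \<alpha> \<beta> (embed x)"
  by (simp_all add: env_class_def env_alg_def quot_alg_ops[OF env_ideal] embed.add embed.scale)

end

theorem theorem3p1:
  fixes scale :: "'k::field \<Rightarrow> 'a::ab_group_add \<Rightarrow> 'a"
    and bracket :: "'a \<Rightarrow> 'a \<Rightarrow> 'a"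
    and triple :: "'a \<Rightarrow> 'a \<Rightarrow> 'a \<Rightarrow> 'a"
    and e :: "'i::wellorder \<Rightarrow> 'a"
    and \<alpha> :: "'i \<Rightarrow> 'i \<Rightarrow> 'i \<Rightarrow>\<^sub>0 'k"
    and \<beta> :: "'i \<Rightarrow> 'i \<Rightarrow> 'i \<Rightarrow> 'i \<Rightarrow>\<^sub>0 'k"
  assumes "akivis_algebra scale bracket triple"
    and "\<exists>a::'a. a \<noteq> 0"
    and "is_basis scale e"
    and "\<And>i j. bracket (e i) (e j) =
           (\<Sum>m\<in>Poly_Mapping.keys (\<alpha> i j). scale (Poly_Mapping.lookup (\<alpha> i j) m) (e m))"
    and "\<And>i j l. triple (e i) (e j) (e l) =
           (\<Sum>n\<in>Poly_Mapping.keys (\<beta> i j l). scale (Poly_Mapping.lookup (\<beta> i j l) n) (e n))"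
  shows "groebner_shirshov_basis (gs_set \<alpha> \<beta>)
    \<and> inj_on (\<lambda>u. env_class \<alpha> \<beta> (word u)) irr_words
    \<and> vectorspace.basis class_ring (env_alg \<alpha> \<beta>) ((\<lambda>u. env_class \<alpha> \<beta> (word u)) ` irr_words)
    \<and> (\<exists>\<phi>. \<phi> \<in> UNIV \<rightarrow> carrier (env_alg \<alpha> \<beta>)
         \<and> (\<forall>x y. \<phi> (x + y) = \<phi> x \<oplus>\<^bsub>env_alg \<alpha> \<beta>\<^esub> \<phi> y)
         \<and> (\<forall>c x. \<phi> (scale c x) = c \<odot>\<^bsub>env_alg \<alpha> \<beta>\<^esub> \<phi> x)
         \<and> (\<forall>i. \<phi> (e i) = env_class \<alpha> \<beta> (gen i))
         \<and> inj \<phi>)"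
proof -
  interpret akivis_algebra_basis scale bracket triple e \<alpha> \<beta>
    using assms by (intro akivis_algebra_basis.intro akivis_algebra_basis_axioms.intro)
  show ?thesis
    using groebner_shirshov_basis_gs_set irr_words_basis env_class_embed_inj env_class_embed_linear
    by (intro conjI exI[of _ "\<lambda>x. env_class \<alpha> \<beta> (embed x)"]) (auto simp: embed_basis)
qed

end
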